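(* For $N\ge1$ let $Q_N$ be the set of triples $a=(a_1,a_2,a_3)$ of positive integers with $1\le a_j\le N$ ($j=1,2,3$) and $\gcd(a_1,a_2,a_3)=1$, and let $P_N$ be the uniform probability measure on $Q_N$. For $a\in Q_N$ let $F(a)$ be the Frobenius number of $a$, i.e. the largest integer not representable as $x_1a_1+x_2a_2+x_3a_3$ with non-negative integers $x_1,x_2,x_3$, and put $f_N(a)=F(a)/N^{3/2}$. Then, as $N\to\infty$, the distribution of the random variable $f_N$ under $P_N$ converges weakly to a limiting probability distribution. *)

theory Defs
  imports "HOL-Probability.Probability"
begin

definition coprime_triples :: "nat \<Rightarrow> (nat \<times> nat \<times> nat) set" where
  "coprime_triples N =
     {(a1, a2, a3). a1 \<in> {1..N} \<and> a2 \<in> {1..N} \<and> a3 \<in> {1..N} \<and> gcd a1 (gcd a2 a3) = 1}"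

definition representable :: "nat \<times> nat \<times> nat \<Rightarrow> int \<Rightarrow> bool" where
  "representable = (\<lambda>(a1, a2, a3) m.
     \<exists>x1 x2 x3 :: nat. m = int (x1 * a1 + x2 * a2 + x3 * a3))"

text \<open>
  The maximum is taken over all integers. Negative integers are never representable, so the
  Frobenius number is at least \<open>-1\<close>, with value \<open>-1\<close> exactly if every natural number
  is representable, that is, if one of the generators is 1.
\<close>

definition frobenius_number :: "nat \<times> nat \<times> nat \<Rightarrow> int" where
  "frobenius_number a = (GREATEST m. \<not> representable a m)"

definition normalized_frobenius :: "nat \<Rightarrow> nat \<times> nat \<times> nat \<Rightarrow> real" where
  "normalized_frobenius N a = real_of_int (frobenius_number a) / real N powr (3/2)"

text \<open>
  The set of triples is finite and contains \<open>(1, 1, 1)\<close> for all \<open>N \<ge> 1\<close>, so this is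
  the uniform distribution on it. For \<open>N = 0\<close> the set is empty and the term is an unspecified
  probability measure, which is irrelevant for the limit as \<open>N\<close> tends to infinity.
\<close>

definition uniform_triples :: "nat \<Rightarrow> (nat \<times> nat \<times> nat) measure" where
  "uniform_triples N = measure_pmf (pmf_of_set (coprime_triples N))"

end

theory Submission
  imports Defs "HOL-Number_Theory.Cong" "HOL-Real_Asymp.Real_Asymp"
begin

text \<open>
  For a triple \<open>a\<close> outside a set of density 0, the minimal relations
  \<open>(\<alpha> + \<alpha>') a\<^sub>1 = \<beta> a\<^sub>2 + \<gamma> a\<^sub>3\<close>, \<open>(\<beta> + \<beta>') a\<^sub>2 = \<alpha> a\<^sub>1 + \<gamma>' a\<^sub>3\<close>,
  \<open>(\<gamma> + \<gamma>') a\<^sub>3 = \<alpha>' a\<^sub>1 + \<beta>' a\<^sub>2\<close> (Johnson, Herzog) have six positive coefficients. They determine \<open>a\<close>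
  by quadratic polynomials and \<open>F(a) + a\<^sub>1 + a\<^sub>2 + a\<^sub>3\<close> by the maximum of two cubic ones, all with nonnegative
  coefficients, and every positive integer vector for which the quadratic polynomials have gcd 1 occurs exactly
  once. So the distribution function of \<open>f\<^sub>N\<close> counts the integer points with this gcd property in the dilation
  by \<open>\<surd>N\<close> of a fixed subset of the positive orthant of \<open>\<real>\<^sup>6\<close>. The subset is downward closed, so that
  inside a box its points are equidistributed in all residue classes with a limiting density. A sieve takes care
  of the gcd, and the part outside a large box contributes little uniformly in \<open>N\<close>. This gives convergence of
  the distribution functions up to an arbitrarily small shift, without loss of mass.
\<close>

section \<open>Apery sets of nonsymmetric triples\<close>

text \<open>With \<open>X = sqrt N\<close> all counts have order \<open>X ^ 6 = N ^ 3\<close>, the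
  order of the number of triples. The region cut out by the bounds on the three generators is
  unbounded in this scaling: one entry can have order \<open>N\<close> while the others stay small.
  In a box of side \<open>K\<close> the sieve loses a term of order \<open>K ^ 5\<close>, which is
  negligible only for \<open>K\<close> of order \<open>sqrt N\<close>. Hence entries are truncated
  at \<open>C * sqrt N\<close> before sieving, and the truncation is removed afterwards. Densities
  are obtained from scaling and monotonicity alone. No volume is computed and no limit is
  identified, so each approximation step passes on convergence through the Cauchy property. The
  shift of the argument has two sources: \<open>F(a)\<close> differs from the homogeneous cubic
  expression by a sum of generators, which is at most \<open>3 * N\<close> and thus small against
  \<open>N powr (3/2)\<close>, and the limit of the counting functions is not known to be continuous
  in the threshold.\<close>

locale johnson_data =
  fixes \<alpha> \<alpha>' \<beta> \<beta>' \<gamma> \<gamma>' a1 a2 a3 :: nat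
  assumes pos: "0 < \<alpha>" "0 < \<alpha>'" "0 < \<beta>" "0 < \<beta>'" "0 < \<gamma>" "0 < \<gamma>'"
    and a1: "a1 = \<beta> * \<gamma> + \<beta> * \<gamma>' + \<beta>' * \<gamma>"
    and a2: "a2 = \<alpha> * \<gamma> + \<alpha> * \<gamma>' + \<alpha>' * \<gamma>'"
    and a3: "a3 = \<alpha> * \<beta>' + \<alpha>' * \<beta> + \<alpha>' * \<beta>'"
    and coprime: "gcd a1 (gcd a2 a3) = 1"
begin

text \<open>Cyclic symmetry of the generators: a fact proved for one of the three relations
  transfers to the other two.\<close>

lemma rotate: "johnson_data \<beta>' \<beta> \<gamma>' \<gamma> \<alpha> \<alpha>' a2 a3 a1"
  using pos coprime by unfold_locales (simp_all add: a1 a2 a3 algebra_simps gcd.commute gcd.left_commute)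

lemma gens_pos: "0 < a1" "0 < a2" "0 < a3"
  using pos by (simp_all add: a1 a2 a3)

lemma relation1: "(\<alpha> + \<alpha>') * a1 = \<beta> * a2 + \<gamma> * a3"
  and relation2: "(\<beta> + \<beta>') * a2 = \<alpha> * a1 + \<gamma>' * a3"
  and relation3: "(\<gamma> + \<gamma>') * a3 = \<alpha>' * a1 + \<beta>' * a2"
  by (simp_all add: a1 a2 a3 algebra_simps)

text \<open>A pair stands for the combination of \<open>a2\<close> and \<open>a3\<close> with these
  coefficients. Relations 2 and 3 bound the sides of the rectangle, relation 1 cuts off its upper
  corner. What remains represents the Apery set with respect to \<open>a1\<close>.\<close>

definition lshape :: "(nat \<times> nat) set" where
  "lshape = {..<\<beta> + \<beta>'} \<times> {..<\<gamma> + \<gamma>'} - {\<beta>..<\<beta> + \<beta>'} \<times> {\<gamma>..<\<gamma> + \<gamma>'}"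

lemma finite_lshape: "finite lshape"
  by (simp add: lshape_def)

lemma card_lshape: "card lshape = a1"
proof -
  have "card lshape = (\<beta> + \<beta>') * (\<gamma> + \<gamma>') - \<beta>' * \<gamma>'"
    unfolding lshape_def by (subst card_Diff_subset) auto
  then show ?thesis by (simp add: a1 algebra_simps)
qed

text \<open>Outside \<open>lshape\<close> one of the three relations trades copies of
  \<open>a2\<close> and \<open>a3\<close> for a positive number of copies of \<open>a1\<close>. The
  value stays fixed and bounds the coefficient of \<open>a1\<close>, so rewriting stops. The last
  conjunct records that an unchanged coefficient of \<open>a1\<close> means that nothing was
  rewritten.\<close>

lemma reduce:
  "\<exists>y1 y2 y3. x1 \<le> y1 \<and> (y2, y3) \<in> lshape \<and> y1 * a1 + y2 * a2 + y3 * a3 = x1 * a1 + x2 * a2 + x3 * a3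
     \<and> (y1 = x1 \<longrightarrow> y2 = x2 \<and> y3 = x3)"
proof (induction "x1 * a1 + x2 * a2 + x3 * a3 - x1" arbitrary: x1 x2 x3 rule: less_induct)
  case less
  have step: ?case
    if lt: "x1 < z1" and eq: "z1 * a1 + z2 * a2 + z3 * a3 = x1 * a1 + x2 * a2 + x3 * a3" for z1 z2 z3
  proof -
    have "z1 \<le> z1 * a1" using gens_pos by simp
    then have "z1 * a1 + z2 * a2 + z3 * a3 - z1 < x1 * a1 + x2 * a2 + x3 * a3 - x1"
      using eq lt by linarith
    from less[OF this] obtain y1 y2 y3 where "z1 \<le> y1" "(y2, y3) \<in> lshape"
      "y1 * a1 + y2 * a2 + y3 * a3 = z1 * a1 + z2 * a2 + z3 * a3" by blast
    then show ?case using lt eq by (intro exI[of _ y1] exI[of _ y2] exI[of _ y3]) auto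
  qed
  consider "(x2, x3) \<in> lshape" | "\<beta> + \<beta>' \<le> x2" | "\<gamma> + \<gamma>' \<le> x3" | "\<beta> \<le> x2" "\<gamma> \<le> x3"
    by (force simp: lshape_def)
  then show ?case
  proof cases
    case 1
    then show ?thesis by blast
  next
    case 2
    then obtain k where k: "x2 = \<beta> + \<beta>' + k" using le_Suc_ex by blast
    show ?thesis
      using relation2 pos by (intro step[of "x1 + \<alpha>" k "x3 + \<gamma>'"]) (simp_all add: k algebra_simps)
  next
    case 3
    then obtain k where k: "x3 = \<gamma> + \<gamma>' + k" using le_Suc_ex by blast
    show ?thesis
      using relation3 pos by (intro step[of "x1 + \<alpha>'" "x2 + \<beta>'" k]) (simp_all add: k algebra_simps)
  next
    case 4
    then obtain k l where k: "x2 = \<beta> + k" "x3 = \<gamma> + l" using le_Suc_ex by blast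
    show ?thesis
      using relation1 pos by (intro step[of "x1 + (\<alpha> + \<alpha>')" k l]) (simp_all add: k algebra_simps)
  qed
qed

definition weight :: "nat \<times> nat \<Rightarrow> nat" where
  "weight s = fst s * a2 + snd s * a3"

text \<open>Since the generators have gcd 1, a Bezout combination represents \<open>t\<close> modulo
  \<open>a1\<close>, and \<open>reduce\<close> moves it into \<open>lshape\<close> without changing
  the residue.\<close>

lemma residue_attained:
  assumes "t < a1"
  shows "\<exists>s\<in>lshape. weight s mod a1 = t"
proof -
  obtain u v where uv: "u * int a2 + v * int a3 = int (gcd a2 a3)"
    using bezout_int[of "int a2" "int a3"] by auto
  obtain p q where pq: "p * int a1 + q * int (gcd a2 a3) = 1"
    using bezout_int[of "int a1" "int (gcd a2 a3)"] coprime by auto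
  have one: "p * int a1 + (q * u) * int a2 + (q * v) * int a3 = 1"
    using uv pq by (simp add: algebra_simps flip: uv)
  \<comment> \<open>Reducing the Bezout coefficients modulo \<open>a1\<close> makes them nonnegative
    and leaves the residue of the combination alone.\<close>
  define x2 x3 where "x2 = nat ((int t * q * u) mod int a1)" and "x3 = nat ((int t * q * v) mod int a1)"
  have x: "int x2 = (int t * q * u) mod int a1" "int x3 = (int t * q * v) mod int a1"
    using gens_pos by (simp_all add: x2_def x3_def)
  have "int (x2 * a2 + x3 * a3) mod int a1 = ((int t * q * u) * int a2 + (int t * q * v) * int a3) mod int a1"
    unfolding of_nat_add of_nat_mult x by (intro mod_add_cong mod_mult_left_eq)
  also have "(int t * q * u) * int a2 + (int t * q * v) * int a3 = int t * (p * int a1 + (q * u) * int a2 + (q * v) * int a3) - (int t * p) * int a1"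
    by (simp add: algebra_simps)
  also have "\<dots> mod int a1 = int t mod int a1"
    unfolding one by (simp add: mod_simps mod_diff_eq[symmetric])
  finally have x23: "(x2 * a2 + x3 * a3) mod a1 = t"
    using assms by (metis mod_less of_nat_eq_iff of_nat_mod)
  obtain y1 y2 y3 where "(y2, y3) \<in> lshape" "y1 * a1 + y2 * a2 + y3 * a3 = 0 * a1 + x2 * a2 + x3 * a3"
    using reduce[of 0 x2 x3] by blast
  moreover from this have "(y2 * a2 + y3 * a3) mod a1 = t"
    using x23 by (metis add.assoc add.commute mod_mult_self1 mult_0 add_0)
  ultimately show ?thesis by (intro bexI[of _ "(y2, y3)"]) (simp_all add: weight_def)
qed

text \<open>Pigeonhole: \<open>lshape\<close> has \<open>a1\<close> elements and they hit all
  \<open>a1\<close> residues.\<close>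

lemma residues_distinct:
  assumes "s \<in> lshape" "s' \<in> lshape" "weight s mod a1 = weight s' mod a1"
  shows "s = s'"
proof -
  have "(\<lambda>s. weight s mod a1) ` lshape = {..<a1}"
    using residue_attained gens_pos by (auto simp: image_iff)
  then have "inj_on (\<lambda>s. weight s mod a1) lshape"
    by (intro eq_card_imp_inj_on finite_lshape) (simp add: card_lshape)
  then show ?thesis using assms by (auto dest: inj_onD)
qed

lemma weight_le:
  assumes "s \<in> lshape"
  shows "weight s \<le> max (weight (\<beta> + \<beta>' - 1, \<gamma> - 1)) (weight (\<beta> - 1, \<gamma> + \<gamma>' - 1))"
proof -
  have "fst s \<le> \<beta> + \<beta>' - 1 \<and> snd s \<le> \<gamma> - 1 \<or> fst s \<le> \<beta> - 1 \<and> snd s \<le> \<gamma> + \<gamma>' - 1"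
    using assms by (auto simp: lshape_def)
  then show ?thesis
    unfolding weight_def by (auto simp: le_max_iff_disj intro!: add_mono mult_le_mono1)
qed

text \<open>The classical formula "largest Apery element minus \<open>a1\<close>". Elements of
  \<open>lshape\<close> have the least representable values in their residue classes, and since
  weights increase in both coordinates, the largest one sits at one of the two outer
  corners.\<close>

lemma frobenius_number_eq:
  "frobenius_number (a1, a2, a3) =
     int (max ((\<beta> + \<beta>') * a2 + \<gamma> * a3) (\<beta> * a2 + (\<gamma> + \<gamma>') * a3)) - int (a1 + a2 + a3)"
proof -
  define W where "W = max (weight (\<beta> + \<beta>' - 1, \<gamma> - 1)) (weight (\<beta> - 1, \<gamma> + \<gamma>' - 1))"
  have corners: "(\<beta> + \<beta>' - 1, \<gamma> - 1) \<in> lshape" "(\<beta> - 1, \<gamma> + \<gamma>' - 1) \<in> lshape"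
    using pos by (auto simp: lshape_def)
  then obtain s0 where s0: "s0 \<in> lshape" "W = weight s0"
    by (metis W_def max_def)
  \<comment> \<open>The corners have coordinates reduced by 1, which produces the subtracted
    \<open>a2 + a3\<close>. Writing the parameters as successors removes the truncated
    subtraction.\<close>
  have W: "int W = int (max ((\<beta> + \<beta>') * a2 + \<gamma> * a3) (\<beta> * a2 + (\<gamma> + \<gamma>') * a3)) - int (a2 + a3)"
  proof -
    obtain b b' c c' where "\<beta> = Suc b" "\<beta>' = Suc b'" "\<gamma> = Suc c" "\<gamma>' = Suc c'"
      using pos by (metis gr0_implies_Suc)
    then show ?thesis by (simp add: W_def weight_def max_def algebra_simps)
  qed
  have "frobenius_number (a1, a2, a3) = int W - int a1"
    unfolding frobenius_number_def
  proof (rule Greatest_equality)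
    show "\<not> representable (a1, a2, a3) (int W - int a1)"
    proof
      assume "representable (a1, a2, a3) (int W - int a1)"
      then obtain x1 x2 x3 where x: "int W - int a1 = int (x1 * a1 + x2 * a2 + x3 * a3)"
        by (auto simp: representable_def)
      obtain y1 y2 y3 where y: "(y2, y3) \<in> lshape"
          "y1 * a1 + y2 * a2 + y3 * a3 = x1 * a1 + x2 * a2 + x3 * a3"
        using reduce[of x1 x2 x3] by blast
      have "int W = int (y1 * a1 + y2 * a2 + y3 * a3 + a1)"
        using x y(2) by simp
      then have *: "W = weight (y2, y3) + a1 * (y1 + 1)"
        unfolding of_nat_eq_iff by (simp add: weight_def algebra_simps)
      then have "(y2, y3) = s0"
        using s0 y(1) by (intro residues_distinct) (metis mod_mult_self2)+
      then show False using * s0(2) gens_pos by simp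
    qed
  next
    fix m assume m: "\<not> representable (a1, a2, a3) m"
    show "m \<le> int W - int a1"
    proof (rule ccontr)
      assume "\<not> m \<le> int W - int a1"
      then have gt: "int W - int a1 < m" by simp
      have "nat (m mod int a1) < a1" using gens_pos by (simp add: nat_less_iff)
      then obtain s where s: "s \<in> lshape" "weight s mod a1 = nat (m mod int a1)"
        using residue_attained by blast
      have "int (weight s) mod int a1 = m mod int a1"
        using s(2) gens_pos by (metis (no_types) Euclidean_Rings.pos_mod_sign int_nat_eq of_nat_0_less_iff of_nat_mod)
      then obtain k where k: "m - int (weight s) = int a1 * k"
        by (metis mod_eq_dvd_iff dvdE)
      have "int a1 * k > int a1 * (-1)"
        using gt weight_le[OF s(1)] k unfolding W_def by simp
      then have "-1 < k" using gens_pos by (subst (asm) mult_less_cancel_left_pos) simp_all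
      then have "m = int (nat k * a1 + fst s * a2 + snd s * a3)"
        using k by (simp add: weight_def algebra_simps)
      then show False using m unfolding representable_def by blast
    qed
  qed
  then show ?thesis using W by simp
qed

text \<open>For smaller \<open>k\<close> the point \<open>(k, 0)\<close> lies in
  \<open>lshape\<close>. Reducing the right-hand side must end in the same point, with no
  \<open>a1\<close> left; then \<open>x = 0\<close> and nothing was rewritten, so the coefficient
  \<open>k\<close> of \<open>a2\<close> would be 0.\<close>

lemma minimal2:
  assumes "0 < k" "k * a2 = x * a1 + y * a3"
  shows "\<beta> + \<beta>' \<le> k"
proof (rule ccontr)
  assume "\<not> \<beta> + \<beta>' \<le> k"
  then have k: "(k, 0) \<in> lshape" using pos by (auto simp: lshape_def)
  obtain y1 y2 y3 where r: "x \<le> y1" "(y2, y3) \<in> lshape"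
      "y1 * a1 + y2 * a2 + y3 * a3 = x * a1 + 0 * a2 + y * a3" "y1 = x \<longrightarrow> y2 = 0 \<and> y3 = y"
    using reduce[of x 0 y] by blast
  have *: "weight (k, 0) = weight (y2, y3) + a1 * y1"
    using r(3) assms(2) by (simp add: weight_def algebra_simps)
  then have yk: "(y2, y3) = (k, 0)" using k r(2) by (intro residues_distinct) auto
  then have "y1 = 0" using * gens_pos by simp
  then show False using r yk assms(1) by simp
qed

lemma minimal3:
  assumes "0 < k" "k * a3 = x * a1 + y * a2"
  shows "\<gamma> + \<gamma>' \<le> k"
  using johnson_data.minimal2[OF rotate assms(1), of y x] assms(2) by simp

lemma minimal1:
  assumes "0 < k" "k * a1 = x * a2 + y * a3"
  shows "\<alpha> + \<alpha>' \<le> k"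
  using johnson_data.minimal3[OF rotate assms(1)] assms(2) by simp

text \<open>Two such representations would differ by a relation between \<open>a1\<close> and
  \<open>a3\<close> alone, with a multiplier at most \<open>\<alpha>\<close> or at most
  \<open>\<gamma>'\<close>, below the minimal multiplier of that generator.\<close>

lemma unique_relation2:
  assumes "(\<beta> + \<beta>') * a2 = x * a1 + y * a3"
  shows "x = \<alpha> \<and> y = \<gamma>'"
proof -
  have eq: "x * a1 + y * a3 = \<alpha> * a1 + \<gamma>' * a3" using assms relation2 by simp
  consider "x < \<alpha>" | "\<alpha> < x" | "x = \<alpha>" by linarith
  then show ?thesis
  proof cases
    case 1
    then obtain d where d: "\<alpha> = x + d" "0 < d" by (metis less_imp_add_positive)
    have e: "y * a3 = d * a1 + \<gamma>' * a3" using eq d by (simp add: algebra_simps)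
    then have "\<gamma>' * a3 \<le> y * a3" by simp
    then have "\<gamma>' \<le> y" using gens_pos by simp
    then obtain e where "y = \<gamma>' + e" using le_Suc_ex by blast
    then have "d * a1 = 0 * a2 + e * a3" using e by (simp add: algebra_simps)
    from minimal1[OF d(2) this] show ?thesis using d pos by simp
  next
    case 2
    then obtain d where d: "x = \<alpha> + d" "0 < d" by (metis less_imp_add_positive)
    have e: "\<gamma>' * a3 = d * a1 + y * a3" using eq d by (simp add: algebra_simps)
    then have "y * a3 < \<gamma>' * a3" using d gens_pos by simp
    then have "y < \<gamma>'" by simp
    then obtain e where ee: "\<gamma>' = y + e" "0 < e" by (metis less_imp_add_positive)
    then have "e * a3 = d * a1 + 0 * a2" using e by (simp add: algebra_simps)
    from minimal3[OF ee(2) this] show ?thesis using ee pos by simp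
  next
    case 3
    then show ?thesis using eq gens_pos by simp
  qed
qed

end

text \<open>Both middle sums are the least multiplier of \<open>a2\<close>, hence equal, and the
  relation with this multiplier is unique. Two rotations of this statement cover the other four
  parameters.\<close>

lemma johnson_data_unique2:
  assumes "johnson_data \<alpha> \<alpha>' \<beta> \<beta>' \<gamma> \<gamma>' a1 a2 a3" "johnson_data x x' y y' z z' a1 a2 a3"
  shows "x = \<alpha> \<and> z' = \<gamma>'"
proof -
  interpret A: johnson_data \<alpha> \<alpha>' \<beta> \<beta>' \<gamma> \<gamma>' a1 a2 a3 by fact
  interpret B: johnson_data x x' y y' z z' a1 a2 a3 by fact
  have "\<beta> + \<beta>' \<le> y + y'" using A.minimal2[OF _ B.relation2] B.pos by simp
  moreover have "y + y' \<le> \<beta> + \<beta>'" using B.minimal2[OF _ A.relation2] A.pos by simp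
  ultimately show ?thesis using A.unique_relation2 B.relation2 by simp
qed

lemma johnson_data_unique:
  assumes "johnson_data \<alpha> \<alpha>' \<beta> \<beta>' \<gamma> \<gamma>' a1 a2 a3" "johnson_data x x' y y' z z' a1 a2 a3"
  shows "x = \<alpha> \<and> x' = \<alpha>' \<and> y = \<beta> \<and> y' = \<beta>' \<and> z = \<gamma> \<and> z' = \<gamma>'"
  using johnson_data_unique2[OF assms]
    johnson_data_unique2[OF assms[THEN johnson_data.rotate]]
    johnson_data_unique2[OF assms[THEN johnson_data.rotate, THEN johnson_data.rotate]]
  by simp

section \<open>Existence of the six parameters\<close>

text \<open>The lower-bound half of minimality: together with a relation
  \<open>m * a = x * b + y * c\<close> and \<open>0 < m\<close> it makes \<open>m\<close> the least
  multiplier.\<close>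

definition relation_free :: "nat \<Rightarrow> nat \<Rightarrow> nat \<Rightarrow> nat \<Rightarrow> bool" where
  "relation_free m a b c \<longleftrightarrow> (\<forall>k x y. 0 < k \<longrightarrow> k * a = x * b + y * c \<longrightarrow> m \<le> k)"

lemma relation_freeD:
  assumes "relation_free m a b c" "k * a = x * b + y * c" "0 < y" "0 < c"
  shows "m \<le> k"
proof -
  have "0 < k * a" unfolding assms(2) using assms(3,4) by simp
  then have "0 < k" by (cases k) simp_all
  then show ?thesis using assms(1)[unfolded relation_free_def, rule_format, OF _ assms(2)] by simp
qed

lemma relation_free_commute: "relation_free m a b c \<Longrightarrow> relation_free m a c b"
  unfolding relation_free_def by (metis add.commute)

lemma minimal_relation_exists:
  assumes "0 < (b::nat)"
  obtains m x y where "0 < m" "m * a = x * b + y * c" "relation_free m a b c"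
proof -
  define P where "P k \<longleftrightarrow> 0 < k \<and> (\<exists>x y. k * a = x * b + y * c)" for k
  have "b * a = a * b + 0 * c" by simp
  then have "P b" unfolding P_def using assms by blast
  then have "P (LEAST k. P k)" "\<And>k. P k \<Longrightarrow> (LEAST k. P k) \<le> k"
    by (auto intro: LeastI Least_le)
  then show ?thesis
    using that unfolding P_def relation_free_def by meson
qed

text \<open>Equivalently, \<open>c\<close> lies in the semigroup generated by \<open>a / gcd a b\<close> and \<open>b / gcd a b\<close>.\<close>

definition glued :: "nat \<Rightarrow> nat \<Rightarrow> nat \<Rightarrow> bool" where
  "glued a b c \<longleftrightarrow> (\<exists>g p q x y. a = g * p \<and> b = g * q \<and> c = x * p + y * q)"

lemma glued_commute: "glued a b c \<longleftrightarrow> glued b a c"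
  unfolding glued_def by (metis add.commute)

text \<open>With \<open>a = g * p\<close>, \<open>b = g * q\<close> in lowest terms, the two-term
  relation forces \<open>q \<le> m\<close>. Write \<open>c = x * p + y * q\<close> with
  \<open>x < q\<close> and integral \<open>y\<close>. A negative \<open>y\<close> would turn this
  into a relation for \<open>a\<close> with multiplier \<open>x < q \<le> m\<close>.\<close>

lemma glued_if_two_term_relation:
  assumes "0 < a" "0 < m" and rel: "m * a = r * b" and free: "relation_free m a b c"
  shows "glued a b c"
proof -
  have "0 < m * a" using assms(1,2) by simp
  then have "0 < b" unfolding rel by (cases b) simp_all
  define g where "g = gcd a b"
  have "0 < g" using \<open>0 < a\<close> by (simp add: g_def)
  obtain p q where a: "a = g * p" and b: "b = g * q" and pq: "coprime p q"
    using gcd_coprime_exists[of a b] \<open>0 < g\<close> unfolding g_def by (auto simp: mult.commute)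
  have "0 < q" using \<open>0 < b\<close> b by simp
  have "m * p = r * q" using rel \<open>0 < g\<close> by (simp add: a b)
  then have "q dvd m * p" by simp
  then have "q dvd m" using pq by (simp add: coprime_dvd_mult_left_iff coprime_commute)
  then have "q \<le> m" using \<open>0 < m\<close> by (simp add: dvd_imp_le)
  obtain x1 where x1: "[p * x1 = Suc 0] (mod q)"
    using cong_solve_coprime_nat[OF pq] by blast
  have x0: "[p * (x1 * c) = c] (mod q)"
    using cong_scalar_right[OF x1, of c] by (simp add: mult.assoc)
  define x where "x = x1 * c mod q"
  have x: "[x * p = c] (mod q)" "x < q"
    using x0 \<open>0 < q\<close> by (simp_all add: x_def cong_def mod_simps mult.commute)
  show ?thesis
  proof (cases "x * p \<le> c")
    case True
    then obtain y where "c = x * p + y * q"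
      using cong_le_nat[of "x * p" c q] x(1) by (auto simp: cong_sym_eq add.commute)
    then show ?thesis using a b unfolding glued_def by blast
  next
    case False
    then obtain y where "x * p = c + y * q"
      using cong_le_nat[of c "x * p" q] x(1) by (auto simp: add.commute)
    then have "x * a = y * b + g * c" by (simp add: a b algebra_simps)
    moreover have "0 < x" using False by (cases x) auto
    ultimately have "m \<le> x" using free unfolding relation_free_def by blast
    then show ?thesis using x(2) \<open>q \<le> m\<close> by simp
  qed
qed

lemma minimal_relation_coeff_pos:
  assumes "0 < a" "0 < m" "m * a = x * b + y * c" "relation_free m a b c" "\<not> glued a b c"
  shows "0 < y"
proof (rule ccontr)
  assume "\<not> 0 < y"
  then have "m * a = x * b" using assms(3) by simp
  then show False using glued_if_two_term_relation assms by blast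
qed

definition degenerate :: "nat \<times> nat \<times> nat \<Rightarrow> bool" where
  "degenerate = (\<lambda>(a, b, c). glued a b c \<or> glued b c a \<or> glued c a b)"

text \<open>If \<open>m1 \<le> y1\<close>, substituting the first relation into the second leaves a
  relation for \<open>b\<close> with the smaller multiplier \<open>m2 - x2\<close>.\<close>

lemma minimal_relations_coeff_less:
  fixes a b c :: nat
  assumes "0 < c" "m1 * a = x2 * b + x3 * c" "m2 * b = y1 * a + y3 * c"
    and "relation_free m2 b a c" "0 < x2" "0 < x3"
  shows "y1 < m1"
proof (rule ccontr)
  assume "\<not> y1 < m1"
  then obtain d where d: "y1 = m1 + d" using le_Suc_ex not_less by blast
  have eq: "m2 * b = d * a + x2 * b + (x3 + y3) * c"
    using assms(2,3) by (simp add: d algebra_simps)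
  moreover have "0 < (x3 + y3) * c" using assms by simp
  ultimately have "x2 * b < m2 * b" by linarith
  then have "x2 < m2" by simp
  then obtain e where e: "m2 = x2 + e" "0 < e" by (metis less_imp_add_positive)
  have "e * b = d * a + (x3 + y3) * c" using eq e by (simp add: algebra_simps)
  then have "m2 \<le> e" using assms(4) e(2) unfolding relation_free_def by blast
  then show False using e assms by simp
qed

text \<open>Adding the two relations leaves one for \<open>c\<close> with multiplier
  \<open>x3 + y3\<close>.\<close>

lemma minimal_relations_coeff_sum:
  fixes a b c :: nat
  assumes "m1 * a = x2 * b + x3 * c" "m2 * b = y1 * a + y3 * c"
    and "y1 < m1" "x2 < m2" "relation_free m3 c a b" "0 < x3"
  shows "m3 \<le> x3 + y3"
proof -
  obtain d e where "m1 = y1 + d" "m2 = x2 + e" using assms by (metis less_imp_add_positive)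
  then have "(x3 + y3) * c = d * a + e * b" using assms by (simp add: algebra_simps)
  then show ?thesis using assms(5)[unfolded relation_free_def, rule_format, of "x3 + y3"] assms(6) by simp
qed

text \<open>Minimal relations, one for each generator, supply the parameters. Nondegeneracy makes
  them positive, and minimality ties the multipliers to the coefficient sums. This makes
  \<open>(a1, a2, a3)\<close> proportional to the quadratic expressions, so that only the factor
  \<open>d\<close> has to be shown to be 1.\<close>

lemma johnson_data_exists:
  assumes pos: "0 < a1" "0 < a2" "0 < a3" and coprime: "gcd a1 (gcd a2 a3) = 1"
    and nondeg: "\<not> degenerate (a1, a2, a3)"
  shows "\<exists>\<alpha> \<alpha>' \<beta> \<beta>' \<gamma> \<gamma>'. johnson_data \<alpha> \<alpha>' \<beta> \<beta>' \<gamma> \<gamma>' a1 a2 a3"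
proof -
  obtain c1 \<beta> \<gamma> where r1: "0 < c1" "c1 * a1 = \<beta> * a2 + \<gamma> * a3" "relation_free c1 a1 a2 a3"
    by (rule minimal_relation_exists[OF pos(2), of a1 a3])
  obtain c2 \<alpha> \<gamma>' where r2: "0 < c2" "c2 * a2 = \<alpha> * a1 + \<gamma>' * a3" "relation_free c2 a2 a1 a3"
    by (rule minimal_relation_exists[OF pos(1), of a2 a3])
  obtain c3 \<alpha>' \<beta>' where r3: "0 < c3" "c3 * a3 = \<alpha>' * a1 + \<beta>' * a2" "relation_free c3 a3 a1 a2"
    by (rule minimal_relation_exists[OF pos(1), of a3 a2])
  have ng: "\<not> glued a1 a2 a3" "\<not> glued a2 a3 a1" "\<not> glued a3 a1 a2"
       "\<not> glued a2 a1 a3" "\<not> glued a3 a2 a1" "\<not> glued a1 a3 a2"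
    using nondeg by (auto simp: degenerate_def glued_commute)
  note free = r1(3) r2(3) r3(3) r1(3)[THEN relation_free_commute]
    r2(3)[THEN relation_free_commute] r3(3)[THEN relation_free_commute]
  have r1': "c1 * a1 = \<gamma> * a3 + \<beta> * a2" using r1(2) by linarith
  have r2': "c2 * a2 = \<gamma>' * a3 + \<alpha> * a1" using r2(2) by linarith
  have r3': "c3 * a3 = \<beta>' * a2 + \<alpha>' * a1" using r3(2) by linarith
  note pos_coeff = minimal_relation_coeff_pos
  have gt: "0 < \<alpha>" "0 < \<alpha>'" "0 < \<beta>" "0 < \<beta>'" "0 < \<gamma>" "0 < \<gamma>'"
    using pos_coeff[OF pos(2) r2(1) r2' free(5) ng(2)] pos_coeff[OF pos(3) r3(1) r3' free(6) ng(5)]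
      pos_coeff[OF pos(1) r1(1) r1' free(4) ng(6)] pos_coeff[OF pos(3) r3(1) r3(2) free(3) ng(3)]
      pos_coeff[OF pos(1) r1(1) r1(2) free(1) ng(1)] pos_coeff[OF pos(2) r2(1) r2(2) free(2) ng(4)]
    by simp_all
  note less = minimal_relations_coeff_less
  have lt: "\<alpha> < c1" "\<alpha>' < c1" "\<beta> < c2" "\<beta>' < c2" "\<gamma> < c3" "\<gamma>' < c3"
    using less[OF pos(3) r1(2) r2(2) free(2) gt(3,5)]
      less[OF pos(2) r1' r3(2) free(3) gt(5,3)]
      less[OF pos(3) r2(2) r1(2) free(1) gt(1,6)]
      less[OF pos(1) r2' r3' free(6) gt(6,1)]
      less[OF pos(2) r3(2) r1' free(4) gt(2,4)]
      less[OF pos(1) r3' r2' free(5) gt(4,2)] by simp_all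
  note sum = minimal_relations_coeff_sum
  have le: "c3 \<le> \<gamma> + \<gamma>'" "c2 \<le> \<beta> + \<beta>'" "c1 \<le> \<alpha> + \<alpha>'"
    using sum[OF r1(2) r2(2) lt(1,3) free(3) gt(5)]
      sum[OF r1' r3(2) lt(2,5) free(2) gt(3)]
      sum[OF r2' r3' lt(4,6) free(1) gt(1)] by simp_all
  \<comment> \<open>The sum of the relations is an equality between totals that are already ordered
    term by term, so equality holds in each term.\<close>
  have "c1 * a1 + c2 * a2 + c3 * a3 = (\<alpha> + \<alpha>') * a1 + (\<beta> + \<beta>') * a2 + (\<gamma> + \<gamma>') * a3"
    using r1 r2 r3 by (simp add: algebra_simps)
  moreover have "c1 * a1 \<le> (\<alpha> + \<alpha>') * a1" "c2 * a2 \<le> (\<beta> + \<beta>') * a2" "c3 * a3 \<le> (\<gamma> + \<gamma>') * a3"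
    using le by (simp_all add: mult_le_mono1)
  ultimately have "c1 * a1 = (\<alpha> + \<alpha>') * a1" "c2 * a2 = (\<beta> + \<beta>') * a2" "c3 * a3 = (\<gamma> + \<gamma>') * a3"
    by linarith+
  then have c: "c1 = \<alpha> + \<alpha>'" "c2 = \<beta> + \<beta>'" "c3 = \<gamma> + \<gamma>'" using pos by simp_all
  \<comment> \<open>These are the maximal minors of the matrix of the three relations. Eliminating
    \<open>a3\<close>, respectively \<open>a2\<close>, from two of them shows the
    proportionality.\<close>
  define m1 m2 m3 where "m1 = \<beta> * \<gamma> + \<beta> * \<gamma>' + \<beta>' * \<gamma>" and "m2 = \<alpha> * \<gamma> + \<alpha> * \<gamma>' + \<alpha>' * \<gamma>'"
    and "m3 = \<alpha> * \<beta>' + \<alpha>' * \<beta> + \<alpha>' * \<beta>'"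
  have 12: "a1 * m2 = a2 * m1"
  proof -
    have "\<gamma>' * (c1 * a1) + \<gamma> * (\<alpha> * a1) = \<gamma> * (c2 * a2) + \<gamma>' * (\<beta> * a2)"
      unfolding r1(2) r2(2) by (simp add: algebra_simps)
    then show ?thesis by (simp add: m1_def m2_def c algebra_simps)
  qed
  have 13: "a1 * m3 = a3 * m1"
  proof -
    have "\<beta>' * (c1 * a1) + \<beta> * (\<alpha>' * a1) = \<beta> * (c3 * a3) + \<beta>' * (\<gamma> * a3)"
      unfolding r1(2) r3(2) by (simp add: algebra_simps)
    then show ?thesis by (simp add: m1_def m3_def c algebra_simps)
  qed
  have "a1 dvd gcd (a2 * m1) (a3 * m1)"
    unfolding 12[symmetric] 13[symmetric] by simp
  then have "a1 dvd gcd a2 a3 * m1" by (simp add: gcd_mult_distrib_nat mult.commute)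
  then have "a1 dvd m1"
    using coprime by (simp add: coprime_dvd_mult_right_iff coprime_iff_gcd_eq_1)
  then obtain d where d: "m1 = a1 * d" by blast
  have d23: "m2 = a2 * d" "m3 = a3 * d" using 12 13 pos by (simp_all add: d)
  have "0 < m1" using gt by (simp add: m1_def)
  then have "0 < d" using d by simp
  txt \<open>The L-shaped set contains \<^term>\<open>d * a1\<close> points with distinct residues modulo \<^term>\<open>a1\<close>, so \<open>d \<le> 1\<close>.\<close>
  define S where "S = {..<c2} \<times> {..<c3} - {\<beta>..<c2} \<times> {\<gamma>..<c3}"
  have "card S = c2 * c3 - \<beta>' * \<gamma>'"
    unfolding S_def c by (subst card_Diff_subset) auto
  then have cardS: "card S = m1" by (simp add: m1_def c algebra_simps)
  \<comment> \<open>The point would give a relation for \<open>a1\<close>, so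
    \<open>c1 \<le> k\<close>. Subtracting the first relation leaves a relation for
    \<open>a2\<close> or \<open>a3\<close> whose multiplier is too small for a point of
    \<open>S\<close>, or a contradiction in size.\<close>
  have no_rel: False if s: "(i, j) \<in> S" "0 < k" "k * a1 = i * a2 + j * a3" for i j k
  proof -
    have "c1 \<le> k" using r1(3) s unfolding relation_free_def by blast
    then obtain l where l: "k = c1 + l" using le_Suc_ex by blast
    have eq: "l * a1 + \<beta> * a2 + \<gamma> * a3 = i * a2 + j * a3" using s(3) r1(2) by (simp add: l algebra_simps)
    have ij: "i < c2" "j < c3" using s(1) by (auto simp: S_def)
    have "i < \<beta> \<or> j < \<gamma>" using s(1) ij by (auto simp: S_def)
    then consider "i < \<beta>" "j < \<gamma>" | "\<beta> \<le> i" "j < \<gamma>" | "i < \<beta>" "\<gamma> \<le> j" by linarith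
    then show False
    proof cases
      case 1
      then have "i * a2 < \<beta> * a2" "j * a3 < \<gamma> * a3" using pos by simp_all
      then show False using eq by linarith
    next
      case 2
      then obtain e f where ef: "i = \<beta> + e" "\<gamma> = j + f" "0 < f" using le_Suc_ex[of \<beta> i] less_imp_add_positive[of j \<gamma>] by metis
      have k: "e * a2 = l * a1 + f * a3" using eq by (simp add: ef algebra_simps)
      have "c2 \<le> e" using relation_freeD[OF r2(3) k] ef pos by simp
      then show False using ij ef by simp
    next
      case 3
      then obtain e f where ef: "j = \<gamma> + e" "\<beta> = i + f" "0 < f" using le_Suc_ex[of \<gamma> j] less_imp_add_positive[of i \<beta>] by metis
      have k: "e * a3 = l * a1 + f * a2" using eq by (simp add: ef algebra_simps)
      have "c3 \<le> e" using relation_freeD[OF r3(3) k] ef pos by simp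
      then show False using ij ef by simp
    qed
  qed
  have distinct: "(x, y) = (x', y')"
    if s: "(x, y) \<in> S" "(x', y') \<in> S" and eq: "x * a2 + y * a3 = x' * a2 + y' * a3 + k * a1" for x y x' y' k
  proof -
    have lt: "x < c2" "y < c3" "x' < c2" "y' < c3" using s by (auto simp: S_def)
    consider "x' \<le> x" "y' \<le> y" | "x' \<le> x" "y < y'" | "x < x'" "y' \<le> y" | "x < x'" "y < y'" by linarith
    then show ?thesis
    proof cases
      case 1
      then obtain e f where ef: "x = x' + e" "y = y' + f" using le_Suc_ex[of x' x] le_Suc_ex[of y' y] by metis
      have k: "k * a1 = e * a2 + f * a3" using eq by (simp add: ef algebra_simps)
      have "(e, f) \<in> S" using s(1) by (auto simp: ef S_def)
      then have "k = 0" using no_rel k by blast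
      then show ?thesis using k ef pos by simp
    next
      case 2
      then obtain e f where ef: "x = x' + e" "y' = y + f" "0 < f" using le_Suc_ex[of x' x] less_imp_add_positive[of y y'] by metis
      have k: "e * a2 = k * a1 + f * a3" using eq by (simp add: ef algebra_simps)
      have "c2 \<le> e" using relation_freeD[OF r2(3) k] ef pos by simp
      then show ?thesis using lt ef by simp
    next
      case 3
      then obtain e f where ef: "y = y' + e" "x' = x + f" "0 < f" using le_Suc_ex[of y' y] less_imp_add_positive[of x x'] by metis
      have k: "e * a3 = k * a1 + f * a2" using eq by (simp add: ef algebra_simps)
      have "c3 \<le> e" using relation_freeD[OF r3(3) k] ef pos by simp
      then show ?thesis using lt ef by simp
    next
      case 4
      then have "x * a2 < x' * a2" "y * a3 < y' * a3" using pos by simp_all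
      then show ?thesis using eq by linarith
    qed
  qed
  have "inj_on (\<lambda>(x, y). (x * a2 + y * a3) mod a1) S"
  proof (rule inj_onI, clarify)
    fix x y x' y'
    assume s: "(x, y) \<in> S" "(x', y') \<in> S" and eq: "(x * a2 + y * a3) mod a1 = (x' * a2 + y' * a3) mod a1"
    consider k where "x * a2 + y * a3 = x' * a2 + y' * a3 + k * a1"
      | k where "x' * a2 + y' * a3 = x * a2 + y * a3 + k * a1"
      using eq by (metis mod_eq_nat1E mult.commute nat_le_linear)
    then show "x = x' \<and> y = y'"
      using distinct[OF s] distinct[OF s(2,1)] by cases auto
  qed
  moreover have "(\<lambda>(x, y). (x * a2 + y * a3) mod a1) ` S \<subseteq> {..<a1}" using pos by auto
  ultimately have "card S \<le> card {..<a1}" by (intro card_inj_on_le[of _ S]) simp_all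
  then have "a1 * d \<le> a1" using cardS d by simp
  then have "d = 1" using \<open>0 < d\<close> pos by simp
  then have "johnson_data \<alpha> \<alpha>' \<beta> \<beta>' \<gamma> \<gamma>' a1 a2 a3"
    using gt coprime d d23 by unfold_locales (simp_all add: m1_def m2_def m3_def)
  then show ?thesis by blast
qed

section \<open>Degenerate triples are negligible\<close>

text \<open>Telescoping bounds the terms beyond \<open>n\<close> by \<open>1 / n\<close>; the term
  at \<open>n\<close> itself is at most \<open>1 / n\<close> as well, hence the factor 2.\<close>

lemma sum_inverse_squares_le:
  assumes "finite A" "A \<subseteq> {n..}" "0 < n"
  shows "(\<Sum>p\<in>A. 1 / real p ^ 2) \<le> 2 / real n"
proof -
  have tail: "(\<Sum>p=Suc n..<m. 1 / real p ^ 2) \<le> 1 / real n - 1 / real (m - 1)" if "Suc n \<le> m" for m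
    using that
  proof (induction m rule: dec_induct)
    case (step m)
    then obtain k where k: "m = Suc k" "0 < k" using assms(3) by (cases m) auto
    have "1 / real (Suc k) ^ 2 \<le> 1 / real k - 1 / real (Suc k)"
    proof -
      have "1 / real (Suc k) ^ 2 \<le> 1 / (real k * real (Suc k))"
        using k(2) by (intro divide_left_mono) (auto simp: power2_eq_square)
      also have "\<dots> = 1 / real k - 1 / real (Suc k)" using k(2) by (simp add: field_simps)
      finally show ?thesis .
    qed
    then show ?case using step by (simp add: k(1))
  qed simp
  define m where "m = Max (insert n A) + 1"
  have "A \<subseteq> {n..<m}" using assms unfolding m_def by (auto simp: less_Suc_eq_le)
  then have "(\<Sum>p\<in>A. 1 / real p ^ 2) \<le> (\<Sum>p=n..<m. 1 / real p ^ 2)"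
    by (intro sum_mono2) auto
  also have nm: "Suc n \<le> m" using assms(1) by (simp add: m_def)
  then have "(\<Sum>p=n..<m. 1 / real p ^ 2) = 1 / real n ^ 2 + (\<Sum>p=Suc n..<m. 1 / real p ^ 2)"
    by (intro sum.atLeast_Suc_lessThan) simp
  also have "\<dots> \<le> 1 / real n ^ 2 + 1 / real n"
    using tail[OF nm] by (smt (verit) divide_nonneg_nonneg of_nat_0_le_iff)
  also have "\<dots> \<le> 2 / real n" using assms(3) by (simp add: field_simps power2_eq_square)
  finally show ?thesis .
qed

lemma sum_inverse_cubes_le:
  assumes "finite A" "A \<subseteq> {n..}" "0 < n"
  shows "(\<Sum>p\<in>A. 1 / real p ^ 3) \<le> 2 / real n ^ 2"
proof -
  have "(\<Sum>p\<in>A. 1 / real p ^ 3) \<le> (\<Sum>p\<in>A. 1 / real n * (1 / real p ^ 2))"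
    using assms by (intro sum_mono) (auto simp: field_simps power2_eq_square power3_eq_cube)
  also have "\<dots> \<le> 1 / real n * (2 / real n)"
    unfolding sum_distrib_left[symmetric] using sum_inverse_squares_le[OF assms] by (intro mult_left_mono) auto
  finally show ?thesis by (simp add: power2_eq_square)
qed

lemma harm_le: "1 \<le> n \<Longrightarrow> harm n \<le> 1 + ln (real n)"
proof (induction n rule: dec_induct)
  case base
  show ?case by (simp add: harm_def)
next
  case (step n)
  have "ln (real n) - ln (real (Suc n)) \<le> (real n - real (Suc n)) / real (Suc n)"
    using step by (intro ln_diff_le) auto
  then show ?case using step by (simp add: harm_Suc divide_inverse)
qed

lemma real_div_le: "real (m div n) \<le> real m / real n"
  by (rule of_nat_div_le_of_nat) 

text \<open>Split by the common factor \<open>g\<close>. If \<open>G \<le> g\<close>, both cofactors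
  are at most \<open>N / g\<close>, which gives a convergent sum. If \<open>g < G\<close>, the
  triple is determined by \<open>g\<close> and two pairs with product at most \<open>N\<close>; a
  pair may have second entry 0, so there are \<open>N div p + 1\<close> choices for it.\<close>

lemma card_glued_le:
  fixes G N :: nat
  assumes "0 < G" "0 < N"
  shows "real (card {(a, b, c). a \<in> {1..N} \<and> b \<in> {1..N} \<and> c \<in> {1..N} \<and> glued a b c})
    \<le> 2 * real N ^ 3 / G + G * (2 * N * harm N)\<^sup>2"
proof -
  let ?D = "{(a, b, c). a \<in> {1..N} \<and> b \<in> {1..N} \<and> c \<in> {1..N} \<and> glued a b c}"
  define U where "U = (\<Union>g\<in>{G..N}. (\<lambda>(p, q, c). (g * p, g * q, c)) ` ({1..N div g} \<times> {1..N div g} \<times> {1..N}))"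
  define V where "V = (SIGMA p:{1..N}. {0..N div p})"
  define W where "W = (\<lambda>(g, (p, x), (q, y)). (g * p, g * q, x * p + y * q)) ` ({1..G} \<times> V \<times> V)"
  have fin: "finite U" "finite W" "finite V" by (simp_all add: U_def V_def W_def)
  have "?D \<subseteq> U \<union> W"
  proof clarify
    fix a b c assume D: "a \<in> {1..N}" "b \<in> {1..N}" "c \<in> {1..N}" "glued a b c" and W: "(a, b, c) \<notin> W"
    then obtain g p q x y where e: "a = g * p" "b = g * q" "c = x * p + y * q" unfolding glued_def by blast
    have pos: "0 < g" "0 < p" "0 < q" using D e by (auto intro: Nat.gr0I)
    show "(a, b, c) \<in> U"
    proof (cases "G \<le> g")
      case True
      have "p \<le> N div g" "q \<le> N div g" using D e pos by (simp_all add: less_eq_div_iff_mult_less_eq mult.commute)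
      moreover have "g \<le> N" using D(1) e(1) pos by (metis atLeastAtMost_iff le_trans nat_le_iff_add mult_le_mono2 mult_1_right Suc_leI One_nat_def)
      ultimately show ?thesis using True D e pos unfolding U_def
        by (intro UN_I[of g] image_eqI[of _ _ "(p, q, c)"]) auto
    next
      case False
      have "p \<le> g * p" "q \<le> g * q" using pos by simp_all
      moreover have "g * p \<le> N" "g * q \<le> N" using D e by auto
      ultimately have pq: "p \<le> N" "q \<le> N" by (meson le_trans)+
      have "x * p \<le> N" "y * q \<le> N" using D e by auto
      then have "x \<le> N div p" "y \<le> N div q" using pos by (simp_all add: less_eq_div_iff_mult_less_eq)
      then have "(a, b, c) \<in> W" using False pos pq e unfolding W_def V_def
        by (intro image_eqI[of _ _ "(g, (p, x), (q, y))"]) auto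
      then show ?thesis using W by blast
    qed
  qed
  then have "card ?D \<le> card U + card W"
    using fin by (meson card_Un_le card_mono finite_UnI le_trans)
  moreover have "real (card U) \<le> 2 * real N ^ 3 / G"
  proof -
    have "card U \<le> (\<Sum>g\<in>{G..N}. card ((\<lambda>(p, q, c). (g * p, g * q, c)) ` ({1..N div g} \<times> {1..N div g} \<times> {1..N})))"
      unfolding U_def by (rule card_UN_le) simp
    also have "\<dots> \<le> (\<Sum>g\<in>{G..N}. card ({1..N div g} \<times> {1..N div g} \<times> {1..N}))"
      by (intro sum_mono card_image_le) simp
    also have "\<dots> = (\<Sum>g\<in>{G..N}. (N div g) * (N div g) * N)" by (simp add: mult.assoc)
    finally have "real (card U) \<le> (\<Sum>g\<in>{G..N}. real (N div g) * real (N div g) * real N)"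
      by (metis (mono_tags, lifting) of_nat_le_iff of_nat_mult of_nat_sum sum.cong)
    also have "\<dots> \<le> (\<Sum>g\<in>{G..N}. real N ^ 3 * (1 / real g ^ 2))"
    proof (rule sum_mono)
      fix g
      have "real (N div g) * real (N div g) * real N \<le> (N / g) * (N / g) * N"
        by (intro mult_mono real_div_le) auto
      then show "real (N div g) * real (N div g) * real N \<le> real N ^ 3 * (1 / real g ^ 2)"
        by (simp add: power2_eq_square power3_eq_cube)
    qed
    also have "\<dots> \<le> real N ^ 3 * (2 / G)"
      unfolding sum_distrib_left[symmetric] using assms by (intro mult_left_mono sum_inverse_squares_le) auto
    finally show ?thesis by (simp add: mult.commute)
  qed
  moreover have "real (card W) \<le> G * (2 * N * harm N)\<^sup>2"
  proof -
    have "card W \<le> card ({1..G} \<times> V \<times> V)" unfolding W_def using fin by (intro card_image_le) simp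
    then have "real (card W) \<le> G * (real (card V))\<^sup>2"
      by (simp add: card_cartesian_product power2_eq_square flip: of_nat_mult)
    moreover have "real (card V) \<le> 2 * N * harm N"
    proof -
      have "real (card V) = (\<Sum>p\<in>{1..N}. real (N div p) + 1)" unfolding V_def by (simp add: add.commute)
      also have "\<dots> \<le> (\<Sum>p\<in>{1..N}. 2 * N * inverse (real p))"
      proof (rule sum_mono)
        fix p assume p: "p \<in> {1..N}"
        then have "1 \<le> real N / real p" by simp
        then show "real (N div p) + 1 \<le> 2 * N * inverse (real p)"
          using real_div_le[of N p] by (simp add: divide_inverse)
      qed
      also have "\<dots> = 2 * N * harm N" by (simp add: harm_def sum_distrib_left)
      finally show ?thesis .
    qed
    ultimately show ?thesis by (smt (verit, best) mult_left_mono of_nat_0_le_iff power_mono)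
  qed
  ultimately show ?thesis by linarith
qed

lemma glued_negligible:
  "(\<lambda>N. real (card {(a, b, c). a \<in> {1..N} \<and> b \<in> {1..N} \<and> c \<in> {1..N} \<and> glued a b c}) / real N ^ 3) \<longlonglongrightarrow> 0"
proof (rule tendsto_sandwich[OF _ _ tendsto_const])
  \<comment> \<open>With \<open>G\<close> of order \<open>sqrt N\<close> both terms are of order
    \<open>N powr (5/2)\<close> up to a squared logarithm.\<close>
  define G where "G N = nat \<lceil>sqrt (real N)\<rceil>" for N
  let ?B = "\<lambda>N. 2 / sqrt (real N) + 2 * sqrt (real N) * (2 * (1 + ln (real N)))\<^sup>2 / real N"
  show "\<forall>\<^sub>F N in sequentially. real (card {(a, b, c). a \<in> {1..N} \<and> b \<in> {1..N} \<and> c \<in> {1..N} \<and> glued a b c}) / real N ^ 3 \<le> ?B N"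
    using eventually_ge_at_top[of 1]
  proof eventually_elim
    case (elim N)
    have s: "1 \<le> sqrt N" using elim by simp
    then have G: "sqrt N \<le> G N" "G N \<le> 2 * sqrt N" unfolding G_def by linarith+
    have "0 < G N" using G s by linarith
    then have "0 < real (G N) * sqrt N" using s by simp
    have harm: "harm N \<le> 1 + ln (real N)" using elim by (rule harm_le)
    have "real (card {(a, b, c). a \<in> {1..N} \<and> b \<in> {1..N} \<and> c \<in> {1..N} \<and> glued a b c})
        \<le> 2 * real N ^ 3 / G N + G N * (2 * N * harm N)\<^sup>2"
      using card_glued_le \<open>0 < G N\<close> elim by simp
    also have "\<dots> \<le> 2 * real N ^ 3 / sqrt N + 2 * sqrt N * (2 * N * (1 + ln (real N)))\<^sup>2"
      using \<open>0 < real (G N) * sqrt N\<close> G s harm harm_nonneg[of N] by (intro add_mono divide_left_mono mult_mono power_mono) (auto simp: mult_pos_pos)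
    also have "\<dots> = real N ^ 3 * ?B N"
      using elim by (simp add: field_simps power2_eq_square power3_eq_cube)
    finally show ?case using elim by (simp add: field_simps)
  qed
  show "?B \<longlonglongrightarrow> 0" by real_asymp
qed simp

section \<open>Counting lattice points in growing down-sets\<close>

lemma card_functions_into:
  assumes "finite A"
  shows "finite {k :: 'i::finite \<Rightarrow> 'a. \<forall>i. k i \<in> A}" "card {k :: 'i \<Rightarrow> 'a. \<forall>i. k i \<in> A} = card A ^ CARD('i)"
proof -
  have "{k :: 'i \<Rightarrow> 'a. \<forall>i. k i \<in> A} = UNIV \<rightarrow>\<^sub>E A" by auto
  then show "finite {k :: 'i::finite \<Rightarrow> 'a. \<forall>i. k i \<in> A}" "card {k :: 'i \<Rightarrow> 'a. \<forall>i. k i \<in> A} = card A ^ CARD('i)"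
    using assms by (simp_all add: finite_PiE card_PiE)
qed

lemma card_functions_fixed_value:
  assumes "finite A"
  shows "card {k :: 'i::finite \<Rightarrow> 'a. k i = a \<and> (\<forall>j. j \<noteq> i \<longrightarrow> k j \<in> A)} = card A ^ (CARD('i) - 1)"
proof -
  have "{k :: 'i \<Rightarrow> 'a. k i = a \<and> (\<forall>j. j \<noteq> i \<longrightarrow> k j \<in> A)} = PiE UNIV (\<lambda>j. if j = i then {a} else A)"
    by (auto simp: PiE_iff split: if_splits)
  moreover have "card \<dots> = (\<Prod>j\<in>UNIV. if j = i then 1 else card A)"
    by (subst card_PiE) (auto intro!: prod.cong)
  moreover have "\<dots> = card A ^ (CARD('i) - 1)"
    by (subst prod.remove[of _ i]) (simp_all add: card_Diff_singleton)
  ultimately show ?thesis by simp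
qed

text \<open>Lattice points in the dilation by \<open>X\<close> of a bounded down-set. The axioms
  replace the geometry: scaling by integers is exact, and monotonicity bridges the gap to real
  factors.\<close>

locale growing_region =
  fixes E :: "real \<Rightarrow> ('i::finite \<Rightarrow> nat) \<Rightarrow> bool" and C :: real and dim :: nat
  assumes dim: "CARD('i) = dim"
    and C_pos: "0 < C"
    and scale: "0 < M \<Longrightarrow> 0 < X \<Longrightarrow> E X (\<lambda>i. M * k i) \<longleftrightarrow> E (X / real M) k"
    and downward: "E X l \<Longrightarrow> (\<And>i. k i \<le> l i) \<Longrightarrow> E X k"
    and mono: "0 < X \<Longrightarrow> X \<le> Y \<Longrightarrow> E X k \<Longrightarrow> E Y k"
    and bounded: "E X k \<Longrightarrow> real (k i) \<le> C * X"
begin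

definition count :: "real \<Rightarrow> nat" where
  "count X = card {k. (\<forall>i. 0 < k i) \<and> E X k}"

lemma dim_pos: "Suc 0 \<le> dim"
  using dim by (metis One_nat_def Suc_leI zero_less_card_finite)

lemma bounded_nat: "E X k \<Longrightarrow> k i \<le> nat \<lfloor>C * X\<rfloor>"
  using bounded[of X k i] by (simp add: le_nat_floor)

lemma finite_region: "finite {k. E X k}"
  by (rule finite_subset[OF _ card_functions_into(1)[of "{..nat \<lfloor>C * X\<rfloor>}"]]) (auto simp: bounded_nat)

text \<open>The additional points have a zero entry, so they lie on \<open>dim\<close> coordinate
  hyperplanes and are of lower order.\<close>

lemma count_le_closed:
  assumes "0 < X"
  shows "real (card {k. E X k}) \<le> real (count X) + dim * (C * X + 1) ^ (dim - 1)"
proof -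
  define K where "K = nat \<lfloor>C * X\<rfloor>"
  define Z where "Z i = {k :: 'i \<Rightarrow> nat. k i = 0 \<and> (\<forall>j. j \<noteq> i \<longrightarrow> k j \<in> {..K})}" for i
  have finZ: "finite (Z i)" for i
    by (rule finite_subset[OF _ card_functions_into(1)[of "{..K}"]]) (auto simp: Z_def, metis le0)
  have sub: "{k. E X k} \<subseteq> {k. (\<forall>i. 0 < k i) \<and> E X k} \<union> (\<Union>i. Z i)"
    by (auto simp: Z_def bounded_nat K_def)
  have "card {k. E X k} \<le> card ({k. (\<forall>i. 0 < k i) \<and> E X k} \<union> (\<Union>i. Z i))"
    by (rule card_mono[OF _ sub]) (use finite_region[of X] finZ in \<open>auto intro: finite_subset\<close>)
  also have "\<dots> \<le> count X + card (\<Union>i. Z i)"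
    unfolding count_def by (rule card_Un_le)
  also have "card (\<Union>i. Z i) \<le> (\<Sum>i\<in>UNIV. card (Z i))"
    by (rule card_UN_le) simp
  also have "\<dots> = dim * (K + 1) ^ (dim - 1)"
    unfolding Z_def by (subst card_functions_fixed_value) (simp_all add: dim)
  finally have "card {k. E X k} \<le> count X + dim * (K + 1) ^ (dim - 1)" by simp
  then have "real (card {k. E X k}) \<le> real (count X + dim * (K + 1) ^ (dim - 1))"
    unfolding of_nat_le_iff .
  also have "\<dots> = real (count X) + dim * (real K + 1) ^ (dim - 1)" by (simp add: add.commute)
  also have "\<dots> \<le> real (count X) + dim * (C * X + 1) ^ (dim - 1)"
    using assms C_pos by (intro add_left_mono mult_left_mono power_mono) (simp_all add: K_def)
  finally show ?thesis .
qed

text \<open>A residue class is compared with the region scaled down by \<open>M\<close>. Dropping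
  \<open>s\<close> maps the fiber into the closed region; conversely \<open>s i \<le> M\<close>
  gives \<open>s + M * (k - 1) \<le> M * k\<close>, so the positive points, shifted by one, land in
  the fiber.\<close>

lemma fiber_bounds:
  assumes "0 < M" "0 < X" and s: "\<And>i. s i \<in> {1..M}"
  shows "count (X / M) \<le> card {k. E X (\<lambda>i. s i + M * k i)}"
    and "card {k. E X (\<lambda>i. s i + M * k i)} \<le> card {k. E (X / M) k}"
    and "finite {k. E X (\<lambda>i. s i + M * k i)}"
proof -
  have sub: "{k. E X (\<lambda>i. s i + M * k i)} \<subseteq> {k. E (X / M) k}"
  proof clarify
    fix k assume "E X (\<lambda>i. s i + M * k i)"
    then have "E X (\<lambda>i. M * k i)" by (rule downward) simp
    then show "E (X / M) k" using scale assms by simp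
  qed
  then show fin: "finite {k. E X (\<lambda>i. s i + M * k i)}" using finite_region by (rule finite_subset)
  show "card {k. E X (\<lambda>i. s i + M * k i)} \<le> card {k. E (X / M) k}"
    using sub finite_region by (rule card_mono[rotated])
  have "inj_on (\<lambda>k i. k i - 1 :: nat) {k. (\<forall>i. 0 < k i) \<and> E (X / M) k}"
  proof (rule inj_onI)
    fix k l :: "'i \<Rightarrow> nat"
    assume kl: "k \<in> {k. (\<forall>i. 0 < k i) \<and> E (X / M) k}" "l \<in> {k. (\<forall>i. 0 < k i) \<and> E (X / M) k}"
      "(\<lambda>i. k i - 1) = (\<lambda>i. l i - 1)"
    show "k = l"
    proof
      fix i show "k i = l i" using kl fun_cong[OF kl(3), of i] by (simp, metis Suc_pred)
    qed
  qed
  moreover have "(\<lambda>k i. k i - 1) ` {k. (\<forall>i. 0 < k i) \<and> E (X / M) k} \<subseteq> {k. E X (\<lambda>i. s i + M * k i)}"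
  proof clarify
    fix k assume k: "\<forall>i. 0 < k i" "E (X / M) k"
    then have "E X (\<lambda>i. M * k i)" using scale assms by simp
    then show "E X (\<lambda>i. s i + M * (k i - 1))"
    proof (rule downward)
      fix i
      obtain l where "k i = Suc l" using k gr0_implies_Suc by blast
      then show "s i + M * (k i - 1) \<le> M * k i" using s[of i] by simp
    qed
  qed
  ultimately show "count (X / M) \<le> card {k. E X (\<lambda>i. s i + M * k i)}"
    unfolding count_def by (rule card_inj_on_le) (fact fin)
qed

text \<open>Residues are taken in \<open>{1..M}\<close> rather than \<open>{0..<M}\<close>: then the
  positive vectors correspond exactly to all natural quotients \<open>k\<close>.\<close>

lemma card_periodic_eq:
  assumes "0 < M" "0 < X" and periodic: "\<And>r k. P (\<lambda>i. r i + M * k i) \<longleftrightarrow> P r"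
  shows "card {r. (\<forall>i. 0 < r i) \<and> E X r \<and> P r} =
    (\<Sum>s | (\<forall>i. s i \<in> {1..M}) \<and> P s. card {k. E X (\<lambda>i. s i + M * k i)})"
proof -
  let ?S = "{s :: 'i \<Rightarrow> nat. (\<forall>i. s i \<in> {1..M}) \<and> P s}"
  have finS: "finite ?S" by (rule finite_subset[OF _ card_functions_into(1)[of "{1..M}"]]) auto
  have "bij_betw (\<lambda>(s, k) i. s i + M * k i) (SIGMA s:?S. {k. E X (\<lambda>i. s i + M * k i)})
          {r. (\<forall>i. 0 < r i) \<and> E X r \<and> P r}"
  proof (rule bij_betw_byWitness[where f' = "\<lambda>r. (\<lambda>i. (r i - 1) mod M + 1, \<lambda>i. (r i - 1) div M)"])
    have digit: "(a + M * b - 1) mod M + 1 = a \<and> (a + M * b - 1) div M = b" if a: "a \<in> {1..M}" for a b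
    proof -
      obtain c where c: "a = Suc c" "c < M" using a not0_implies_Suc[of a] by auto
      then show ?thesis by simp
    qed
    show "\<forall>x\<in>SIGMA s:?S. {k. E X (\<lambda>i. s i + M * k i)}.
       (\<lambda>r. (\<lambda>i. (r i - 1) mod M + 1, \<lambda>i. (r i - 1) div M)) ((\<lambda>(s, k) i. s i + M * k i) x) = x"
      using digit by (auto simp: fun_eq_iff)
    have undigit: "(a - 1) mod M + 1 + M * ((a - 1) div M) = a" if "0 < a" for a
      using that by (cases a) (simp_all add: add.commute)
    show "\<forall>r\<in>{r. (\<forall>i. 0 < r i) \<and> E X r \<and> P r}.
       (\<lambda>(s, k) i. s i + M * k i) (\<lambda>i. (r i - 1) mod M + 1, \<lambda>i. (r i - 1) div M) = r"
      using undigit by (auto simp: fun_eq_iff)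
    show "(\<lambda>(s, k) i. s i + M * k i) ` (SIGMA s:?S. {k. E X (\<lambda>i. s i + M * k i)})
       \<subseteq> {r. (\<forall>i. 0 < r i) \<and> E X r \<and> P r}"
      using periodic by (fastforce simp: Suc_le_eq)
    show "(\<lambda>r. (\<lambda>i. (r i - 1) mod M + 1, \<lambda>i. (r i - 1) div M)) ` {r. (\<forall>i. 0 < r i) \<and> E X r \<and> P r}
       \<subseteq> (SIGMA s:?S. {k. E X (\<lambda>i. s i + M * k i)})"
    proof clarify
      fix r assume r: "\<forall>i. 0 < r i" "E X r" "P r"
      have eq: "(\<lambda>i. (r i - 1) mod M + 1 + M * ((r i - 1) div M)) = r"
        using undigit r(1) by (auto simp: fun_eq_iff)
      have E': "E X (\<lambda>i. (r i - 1) mod M + 1 + M * ((r i - 1) div M))" unfolding eq by fact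
      have "P (\<lambda>i. (r i - 1) mod M + 1)"
        using periodic[of "\<lambda>i. (r i - 1) mod M + 1" "\<lambda>i. (r i - 1) div M"] r(3) unfolding eq by simp
      moreover have "(r i - 1) mod M + 1 \<in> {1..M}" for i
        using assms(1) by (simp add: Suc_le_eq)
      ultimately show "(\<lambda>i. (r i - 1) mod M + 1) \<in> ?S \<and> (\<lambda>i. (r i - 1) div M) \<in> {k. E X (\<lambda>i. (r i - 1) mod M + 1 + M * k i)}"
        using E' by blast
    qed
  qed
  then have "card {r. (\<forall>i. 0 < r i) \<and> E X r \<and> P r} = card (SIGMA s:?S. {k. E X (\<lambda>i. s i + M * k i)})"
    by (simp add: bij_betw_same_card)
  also have "\<dots> = (\<Sum>s\<in>?S. card {k. E X (\<lambda>i. s i + M * k i)})"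
    using finS fiber_bounds(3)[OF assms(1,2)] by (intro card_SigmaI) auto
  finally show ?thesis .
qed

text \<open>Constant of the boundary term for \<open>1 \<le> Y\<close>. That term, of order
  \<open>Y ^ (dim - 1)\<close>, is written below as \<open>err / Y * Y ^ dim\<close>, ready for
  division by \<open>Y ^ dim\<close>.\<close>

definition err :: real where "err = dim * (C + 1) ^ (dim - 1)"

lemma closed_count_ratio:
  assumes "1 \<le> Y"
  shows "real (card {k. E Y k}) \<le> real (count Y) + err / Y * Y ^ dim"
proof -
  have "C * Y + 1 \<le> (C + 1) * Y" using assms by (simp add: algebra_simps)
  then have "(C * Y + 1) ^ (dim - 1) \<le> ((C + 1) * Y) ^ (dim - 1)"
    using assms C_pos by (intro power_mono) auto
  also have "\<dots> = (C + 1) ^ (dim - 1) * (Y ^ dim / Y)"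
    using assms by (simp add: power_mult_distrib power_diff dim_pos)
  finally have "real dim * (C * Y + 1) ^ (dim - 1) \<le> real dim * ((C + 1) ^ (dim - 1) * (Y ^ dim / Y))"
    by (rule mult_left_mono) simp
  then have "dim * (C * Y + 1) ^ (dim - 1) \<le> err / Y * Y ^ dim"
    by (simp add: err_def)
  then show ?thesis using count_le_closed[of Y] assms by linarith
qed

lemma periodic_bounds:
  fixes c :: real
  assumes "0 < M" "real M \<le> X" and periodic: "\<And>r k. P (\<lambda>i. r i + M * k i) \<longleftrightarrow> P r"
  defines "c \<equiv> real (card {s :: 'i \<Rightarrow> nat. (\<forall>i. s i \<in> {1..M}) \<and> P s})"
  shows "c * count (X / M) \<le> card {r. (\<forall>i. 0 < r i) \<and> E X r \<and> P r}"
    and "card {r. (\<forall>i. 0 < r i) \<and> E X r \<and> P r} \<le> c * (count (X / M) + err / (X / M) * (X / M) ^ dim)"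
proof -
  have X: "0 < X" using assms by linarith
  let ?S = "{s :: 'i \<Rightarrow> nat. (\<forall>i. s i \<in> {1..M}) \<and> P s}"
  have eq: "real (card {r. (\<forall>i. 0 < r i) \<and> E X r \<and> P r}) = (\<Sum>s\<in>?S. real (card {k. E X (\<lambda>i. s i + M * k i)}))"
    unfolding card_periodic_eq[OF assms(1) X, where P = P, OF periodic] by simp
  have "(\<Sum>s\<in>?S. real (count (X / M))) \<le> (\<Sum>s\<in>?S. real (card {k. E X (\<lambda>i. s i + M * k i)}))"
    using fiber_bounds(1)[OF assms(1) X] by (intro sum_mono) simp
  then show "c * count (X / M) \<le> card {r. (\<forall>i. 0 < r i) \<and> E X r \<and> P r}"
    unfolding eq by (simp add: c_def)
  have "1 \<le> X / M" using assms by simp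
  then have "real (card {k. E X (\<lambda>i. s i + M * k i)}) \<le> count (X / M) + err / (X / M) * (X / M) ^ dim"
    if "s \<in> ?S" for s
    using closed_count_ratio[of "X / M"] fiber_bounds(2)[OF assms(1) X, of s] that by force
  then have "(\<Sum>s\<in>?S. real (card {k. E X (\<lambda>i. s i + M * k i)}))
      \<le> (\<Sum>s\<in>?S. count (X / M) + err / (X / M) * (X / M) ^ dim)"
    by (intro sum_mono)
  then show "card {r. (\<forall>i. 0 < r i) \<and> E X r \<and> P r} \<le> c * (count (X / M) + err / (X / M) * (X / M) ^ dim)"
    unfolding eq by (simp add: c_def)
qed

section \<open>Convergence of the normalised count\<close>

definition ratio :: "real \<Rightarrow> real" where "ratio X = count X / X ^ dim"

lemma count_mono:
  assumes "0 < X" "X \<le> Y"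
  shows "count X \<le> count Y"
proof -
  have "{k. (\<forall>i. 0 < k i) \<and> E X k} \<subseteq> {k. (\<forall>i. 0 < k i) \<and> E Y k}"
    using mono[OF assms] by blast
  then show ?thesis
    unfolding count_def by (rule card_mono[rotated]) (rule finite_subset[OF _ finite_region[of Y]], blast)
qed

text \<open>
  Every residue class modulo \<open>M\<close> contributes to \<open>count (M * Y)\<close> at least \<open>count Y\<close>, and at most the number of
  points of the closed orthant, which differs from \<open>count Y\<close> by a boundary term. So \<open>ratio\<close> is almost
  increasing along multiples and converges to its supremum.
\<close>

lemma ratio_multiple:
  fixes M :: nat and Y :: real
  assumes "0 < M" "1 \<le> Y"
  shows "ratio Y \<le> ratio (M * Y)" "ratio (M * Y) \<le> ratio Y + err / Y"
proof -
  have c: "real (card {s :: 'i \<Rightarrow> nat. (\<forall>i. s i \<in> {1..M}) \<and> True}) = M ^ dim"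
    using card_functions_into(2)[of "{1..M}", where 'i = 'i] by (simp add: dim)
  have MY: "real M \<le> M * Y" "M * Y / M = Y" using assms by simp_all
  note b = periodic_bounds[OF assms(1) MY(1), of "\<lambda>_. True", unfolded c MY(2)]
  have *: "0 < real M ^ dim" "0 < Y ^ dim" "ratio (M * Y) = count (M * Y) / (M ^ dim * Y ^ dim)"
    using assms by (simp_all add: ratio_def power_mult_distrib)
  show "ratio Y \<le> ratio (M * Y)"
    using b(1) * unfolding *(3) by (simp add: ratio_def count_def field_simps)
  have "real (count (M * Y)) \<le> M ^ dim * (count Y + err / Y * Y ^ dim)"
    using b(2) by (simp add: count_def)
  then have "ratio (M * Y) \<le> M ^ dim * (count Y + err / Y * Y ^ dim) / (M ^ dim * Y ^ dim)"
    unfolding *(3) using * by (intro divide_right_mono) auto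
  also have "\<dots> = (count Y + err / Y * Y ^ dim) / Y ^ dim" using * assms by (simp del: times_divide_eq_left)
  also have "\<dots> = ratio Y + err / Y" using * assms by (simp add: ratio_def add_divide_distrib)
  finally show "ratio (M * Y) \<le> ratio Y + err / Y" .
qed

lemma ratio_nonneg: "0 < X \<Longrightarrow> 0 \<le> ratio X"
  by (simp add: ratio_def)

text \<open>Common multiples of \<open>X\<close> and \<open>Y\<close> need not exist. Instead
  \<open>k * X\<close> is compared with the next multiple \<open>l * Y\<close> above it; the
  quotient of the two tends to 1 as \<open>k\<close> grows.\<close>

lemma ratio_le:
  assumes "1 \<le> X" "1 \<le> Y"
  shows "ratio X \<le> ratio Y + err / Y"
proof -
  have bound: "ratio X \<le> (ratio Y + err / Y) * (1 + 1 / real k * (Y / X)) ^ dim" if "1 \<le> k" for k :: nat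
  proof -
    define l where "l = nat \<lceil>real k * X / Y\<rceil>"
    have kXY: "0 < real k * X / Y" using that assms by simp
    then have l: "real k * X / Y \<le> l" "l < real k * X / Y + 1" unfolding l_def by linarith+
    have l1: "1 \<le> l" using l kXY by simp
    have kX: "1 \<le> real k * X" using that assms by (simp add: mult_ge1_I)
    have lY: "real k * X \<le> real l * Y" using l(1) assms by (simp add: field_simps)
    have *: "(real k * X) ^ dim > 0" "(real l * Y) ^ dim > 0" using kX l1 assms by auto
    have "ratio X \<le> ratio (real k * X)" using ratio_multiple(1)[where M = k and Y = X] that assms by simp
    also have "\<dots> \<le> count (real l * Y) / (real k * X) ^ dim"
      unfolding ratio_def using count_mono[OF _ lY] kX * by (intro divide_right_mono) auto
    also have "\<dots> = ratio (real l * Y) * (real l * Y / (real k * X)) ^ dim"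
      using * kX l1 assms by (simp add: ratio_def power_divide)
    also have "\<dots> \<le> (ratio Y + err / Y) * (real l * Y / (real k * X)) ^ dim"
      using ratio_multiple(2)[where M = l and Y = Y] l1 assms kX by (intro mult_right_mono) auto
    also have "\<dots> \<le> (ratio Y + err / Y) * (1 + 1 / real k * (Y / X)) ^ dim"
    proof (intro mult_left_mono power_mono)
      have "real l * Y \<le> real k * X + Y" using l(2) assms by (simp add: field_simps)
      then show "real l * Y / (real k * X) \<le> 1 + 1 / real k * (Y / X)" using kX that assms by (simp add: field_simps)
      show "0 \<le> ratio Y + err / Y" using ratio_nonneg[of Y] assms C_pos by (simp add: err_def)
    qed (use kX assms in auto)
    finally show ?thesis .
  qed
  have "(\<lambda>k. (ratio Y + err / Y) * (1 + 1 / real k * (Y / X)) ^ dim) \<longlonglongrightarrow> (ratio Y + err / Y) * (1 + 0 * (Y / X)) ^ dim"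
    by (intro tendsto_intros lim_1_over_n)
  then show ?thesis
    using bound by (intro LIMSEQ_le_const) auto
qed

lemma ratio_converges: "\<exists>L. (ratio \<longlongrightarrow> L) at_top"
proof -
  define L where "L = (SUP X\<in>{1..}. ratio X)"
  have bdd: "bdd_above (ratio ` {1..})"
    using ratio_le[of _ 1] by (auto intro!: bdd_aboveI2)
  have ev: "\<forall>\<^sub>F Y in at_top. L - err / Y \<le> ratio Y \<and> ratio Y \<le> L"
    using eventually_ge_at_top[of 1]
  proof eventually_elim
    case (elim Y)
    have "L \<le> ratio Y + err / Y"
      unfolding L_def using ratio_le[OF _ elim] by (intro cSUP_least) auto
    moreover have "ratio Y \<le> L" unfolding L_def using elim bdd by (intro cSUP_upper) auto
    ultimately show ?case by simp
  qed
  have lim: "((\<lambda>Y. L - err / Y) \<longlongrightarrow> L) at_top" by real_asymp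
  have "(ratio \<longlongrightarrow> L) at_top"
    by (rule tendsto_sandwich[OF _ _ lim tendsto_const]; rule eventually_mono[OF ev]; blast)
  then show ?thesis by blast
qed

text \<open>All \<open>M ^ dim\<close> residue classes receive the same limiting share, so the limit
  is the limit of \<open>ratio\<close> times the proportion of classes satisfying
  \<open>P\<close>.\<close>

theorem periodic_density:
  assumes "0 < M" and periodic: "\<And>r k. P (\<lambda>i. r i + M * k i) \<longleftrightarrow> P r"
  shows "\<exists>L. ((\<lambda>X. card {r. (\<forall>i. 0 < r i) \<and> E X r \<and> P r} / X ^ dim) \<longlongrightarrow> L) at_top"
proof -
  obtain L where L: "(ratio \<longlongrightarrow> L) at_top" using ratio_converges by blast
  define c where "c = real (card {s :: 'i \<Rightarrow> nat. (\<forall>i. s i \<in> {1..M}) \<and> P s})"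
  have "filterlim (\<lambda>X. X / real M) at_top at_top"
    using assms(1) by real_asymp
  from filterlim_compose[OF L this] have lim: "((\<lambda>X. ratio (X / M)) \<longlongrightarrow> L) at_top" .
  have ev: "\<forall>\<^sub>F X in at_top. c / M ^ dim * ratio (X / M) \<le> card {r. (\<forall>i. 0 < r i) \<and> E X r \<and> P r} / X ^ dim \<and>
     card {r. (\<forall>i. 0 < r i) \<and> E X r \<and> P r} / X ^ dim \<le> c / M ^ dim * (ratio (X / M) + err / (X / M))"
    using eventually_ge_at_top[of "real M"]
  proof eventually_elim
    case (elim X)
    have X: "0 < X" "0 < X ^ dim" "0 < real M ^ dim" using elim assms(1) by auto
    note b = periodic_bounds[OF assms(1) elim, where P = P, OF periodic, folded c_def]
    have "c / M ^ dim * ratio (X / M) = c * count (X / M) / X ^ dim"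
      using X assms(1) by (simp add: ratio_def power_divide)
    moreover have "c / M ^ dim * (ratio (X / M) + err / (X / M)) = c * (count (X / M) + err / (X / M) * (X / M) ^ dim) / X ^ dim"
      using X assms(1) by (simp add: ratio_def power_divide field_simps)
    ultimately show ?case using b X by (simp add: divide_right_mono)
  qed
  have lower: "((\<lambda>X. c / M ^ dim * ratio (X / M)) \<longlongrightarrow> c / M ^ dim * L) at_top"
    by (intro tendsto_intros lim)
  have "((\<lambda>X. err / (X / M)) \<longlongrightarrow> 0) at_top" using assms(1) by real_asymp
  then have "((\<lambda>X. c / M ^ dim * (ratio (X / M) + err / (X / M))) \<longlongrightarrow> c / M ^ dim * (L + 0)) at_top"
    by (intro tendsto_intros lim)
  then have upper: "((\<lambda>X. c / M ^ dim * (ratio (X / M) + err / (X / M))) \<longlongrightarrow> c / M ^ dim * L) at_top"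
    by simp
  have "((\<lambda>X. card {r. (\<forall>i. 0 < r i) \<and> E X r \<and> P r} / X ^ dim) \<longlongrightarrow> c / M ^ dim * L) at_top"
    by (rule tendsto_sandwich[OF _ _ lower upper]; rule eventually_mono[OF ev]; blast)
  then show ?thesis by blast
qed

end

section \<open>Common prime factors of the generators\<close>

text \<open>The entries of a vector \<open>r :: index \<Rightarrow> nat\<close> are the parameters \<open>\<alpha>, \<alpha>', \<beta>, \<beta>', \<gamma>, \<gamma>'\<close> of \<open>johnson_data\<close>.\<close>

datatype index = Al | Al' | Be | Be' | Ga | Ga'

lemma UNIV_index: "UNIV = {Al, Al', Be, Be', Ga, Ga'}"
  using index.exhaust by blast

instance index :: finite
  by standard (simp add: UNIV_index)

lemma card_index: "CARD(index) = 6"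
  by (simp add: UNIV_index)

definition gen1 :: "(index \<Rightarrow> nat) \<Rightarrow> nat" where
  "gen1 r = r Be * r Ga + r Be * r Ga' + r Be' * r Ga"

definition gen2 :: "(index \<Rightarrow> nat) \<Rightarrow> nat" where
  "gen2 r = r Al * r Ga + r Al * r Ga' + r Al' * r Ga'"

definition gen3 :: "(index \<Rightarrow> nat) \<Rightarrow> nat" where
  "gen3 r = r Al * r Be' + r Al' * r Be + r Al' * r Be'"

text \<open>The Frobenius number plus the sum of the generators, see \<open>frobenius_number_eq\<close>.\<close>

definition frob :: "(index \<Rightarrow> nat) \<Rightarrow> nat" where
  "frob r = max ((r Be + r Be') * gen2 r + r Ga * gen3 r) (r Be * gen2 r + (r Ga + r Ga') * gen3 r)"

lemmas gen_defs = gen1_def gen2_def gen3_def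

definition box :: "nat \<Rightarrow> (index \<Rightarrow> nat) set" where
  "box K = {r. \<forall>i. r i \<in> {1..K}}"

lemma finite_box: "finite (box K)"
  unfolding box_def by (rule card_functions_into) simp

lemma card_Sigma_le:
  fixes m :: real
  assumes "finite Q" "\<And>q. q \<in> Q \<Longrightarrow> finite (R q)" "\<And>q. q \<in> Q \<Longrightarrow> real (card (R q)) \<le> m"
  shows "real (card (SIGMA q:Q. R q)) \<le> card Q * m"
proof -
  have "real (card (SIGMA q:Q. R q)) = (\<Sum>q\<in>Q. real (card (R q)))"
    using assms by (simp add: card_SigmaI)
  also have "\<dots> \<le> (\<Sum>q\<in>Q. m)" using assms by (intro sum_mono)
  finally show ?thesis by simp
qed

text \<open>As \<open>c\<close> is invertible modulo \<open>p\<close>, the residue of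
  \<open>y\<close> is fixed and \<open>y\<close> is determined by \<open>y div p\<close>.\<close>

lemma card_residue_class_le:
  fixes c d K p :: nat
  assumes "prime p" "\<not> p dvd c"
  shows "card {y \<in> {1..K}. p dvd c * y + d} \<le> K div p + 1"
proof -
  have "inj_on (\<lambda>y. y div p) {y \<in> {1..K}. p dvd c * y + d}"
  proof (rule inj_onI)
    fix x y assume xy: "x \<in> {y \<in> {1..K}. p dvd c * y + d}" "y \<in> {y \<in> {1..K}. p dvd c * y + d}" "x div p = y div p"
    then have "[c * x + d = c * y + d] (mod p)" by (simp add: cong_def dvd_eq_mod_eq_0)
    then have "[c * x = c * y] (mod p)" by (simp add: cong_add_rcancel_nat)
    moreover have "coprime c p" using assms prime_imp_coprime coprime_commute by blast
    ultimately have "x mod p = y mod p" by (simp add: cong_mult_lcancel_nat cong_def[of x])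
    then show "x = y" using xy(3) by (metis div_mult_mod_eq)
  qed
  moreover have "(\<lambda>y. y div p) ` {y \<in> {1..K}. p dvd c * y + d} \<subseteq> {0..K div p}"
    by (auto intro: div_le_mono)
  ultimately have "card {y \<in> {1..K}. p dvd c * y + d} \<le> card {0..K div p}"
    by (rule card_inj_on_le) simp
  then show ?thesis by simp
qed

lemma card_residue_class_le_real:
  fixes c d K p :: nat
  assumes "prime p" "\<not> p dvd c"
  shows "real (card {y \<in> {1..K}. p dvd c * y + d}) \<le> K / p + 1"
  using card_residue_class_le[OF assms, of K d] real_div_le[of K p] by linarith

text \<open>Four entries range freely up to \<open>K\<close>, and they confine the other two to sets
  of size at most \<open>m\<close>.\<close>

lemma card_le_two_constrained:
  assumes Z: "Z \<subseteq> box K" and idx: "{i1, i2, i3, i4, j1, j2} = (UNIV :: index set)"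
    and R: "\<And>r. r \<in> Z \<Longrightarrow> r j1 \<in> R1 (r i1, r i2, r i3, r i4) \<and> r j2 \<in> R2 (r i1, r i2, r i3, r i4)"
    and fin: "\<And>q. finite (R1 q)" "\<And>q. finite (R2 q)"
    and le: "\<And>q. real (card (R1 q)) \<le> m" "\<And>q. real (card (R2 q)) \<le> m"
  shows "real (card Z) \<le> real K ^ 4 * m\<^sup>2"
proof -
  let ?Q = "{1..K} \<times> {1..K} \<times> {1..K} \<times> {1..K}"
  let ?f = "\<lambda>r :: index \<Rightarrow> nat. ((r i1, r i2, r i3, r i4), r j1, r j2)"
  have "inj_on ?f Z"
  proof (rule inj_onI)
    fix r s assume eq: "?f r = ?f s"
    show "r = s"
    proof
      fix i
      have "i \<in> {i1, i2, i3, i4, j1, j2}" using idx by simp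
      then show "r i = s i" using eq by auto
    qed
  qed
  moreover have "?f ` Z \<subseteq> (SIGMA q:?Q. R1 q \<times> R2 q)"
    using Z R unfolding box_def by blast
  ultimately have "card Z \<le> card (SIGMA q:?Q. R1 q \<times> R2 q)"
    by (rule card_inj_on_le) (use fin in auto)
  also have "real (card (SIGMA q:?Q. R1 q \<times> R2 q)) \<le> card ?Q * m\<^sup>2"
  proof (rule card_Sigma_le)
    show "real (card (R1 q \<times> R2 q)) \<le> m\<^sup>2" for q
      unfolding card_cartesian_product power2_eq_square of_nat_mult
      using le[of q] order_trans[OF of_nat_0_le_iff le(1)] by (intro mult_mono) auto
  qed (use fin in auto)
  finally show ?thesis by (simp add: card_cartesian_product power4_eq_xxxx mult.assoc)
qed

text \<open>If \<open>p\<close> does not divide \<open>r Al + r Al'\<close>, then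
  \<open>gen3\<close> and \<open>gen2\<close> are linear in \<open>r Be'\<close> and
  \<open>r Ga'\<close> with this invertible coefficient, which fixes both modulo \<open>p\<close>.
  Otherwise they reduce to \<open>r Al' * r Be\<close> and \<open>r Al * r Ga\<close>, so
  \<open>p\<close> divides both of \<open>r Al\<close>, \<open>r Al'\<close> or both of
  \<open>r Be\<close>, \<open>r Ga\<close>.\<close>

lemma card_gens_divisible_le:
  assumes p: "prime p"
  shows "real (card {r \<in> box K. p dvd gen2 r \<and> p dvd gen3 r}) \<le> 3 * real K ^ 4 * (K / p + 1)\<^sup>2"
proof -
  define Z1 where "Z1 = {r \<in> box K. \<not> p dvd r Al + r Al' \<and> p dvd gen2 r \<and> p dvd gen3 r}"
  define Z2 where "Z2 = {r \<in> box K. p dvd r Al \<and> p dvd r Al'}"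
  define Z3 where "Z3 = {r \<in> box K. p dvd r Be \<and> p dvd r Ga}"
  have fin: "finite Z1" "finite Z2" "finite Z3"
    using finite_box[of K] by (simp_all add: Z1_def Z2_def Z3_def)
  have gen2: "gen2 r = r Al * r Ga + (r Al + r Al') * r Ga'" for r
    by (simp add: gen2_def algebra_simps)
  have gen3: "gen3 r = (r Al + r Al') * r Be' + r Al' * r Be" for r
    by (simp add: gen3_def algebra_simps)
  have "{r \<in> box K. p dvd gen2 r \<and> p dvd gen3 r} \<subseteq> Z1 \<union> (Z2 \<union> Z3)"
  proof
    fix r assume r: "r \<in> {r \<in> box K. p dvd gen2 r \<and> p dvd gen3 r}"
    show "r \<in> Z1 \<union> (Z2 \<union> Z3)"
    proof (cases "p dvd r Al + r Al'")
      case True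
      then have "p dvd r Al * r Ga" "p dvd r Al' * r Be"
        using r by (auto simp: gen2 gen3 dvd_add_left_iff dvd_add_right_iff)
      then have "p dvd r Al \<or> p dvd r Ga" "p dvd r Al' \<or> p dvd r Be"
        using p by (simp_all add: prime_dvd_mult_iff)
      moreover have "p dvd r Al \<longleftrightarrow> p dvd r Al'"
        using True dvd_add_right_iff dvd_add_left_iff by blast
      ultimately show ?thesis using r by (auto simp: Z2_def Z3_def)
    qed (use r in \<open>simp add: Z1_def\<close>)
  qed
  then have "card {r \<in> box K. p dvd gen2 r \<and> p dvd gen3 r} \<le> card (Z1 \<union> (Z2 \<union> Z3))"
    using fin by (intro card_mono) auto
  also have "\<dots> \<le> card Z1 + (card Z2 + card Z3)"
    by (meson add_left_mono card_Un_le le_trans)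
  finally have card: "real (card {r \<in> box K. p dvd gen2 r \<and> p dvd gen3 r}) \<le> real (card Z1) + (real (card Z2) + real (card Z3))"
    by linarith
  let ?M = "{y \<in> {1..K}. p dvd 1 * y + 0}"
  have one: "\<not> p dvd 1" using p by (simp add: prime_nat_iff)
  have M: "finite ?M" "real (card ?M) \<le> K / p + 1" using card_residue_class_le_real[OF p one, of K 0] by simp_all
  have "real (card Z2) \<le> real K ^ 4 * (K / p + 1)\<^sup>2"
    by (rule card_le_two_constrained[where ?i1.0 = Be and ?i2.0 = Be' and ?i3.0 = Ga and ?i4.0 = Ga' and ?j1.0 = Al and ?j2.0 = Al'
          and ?R1.0 = "\<lambda>_. ?M" and ?R2.0 = "\<lambda>_. ?M"])
      (use M in \<open>auto simp: Z2_def box_def UNIV_index\<close>)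
  moreover have "real (card Z3) \<le> real K ^ 4 * (K / p + 1)\<^sup>2"
    by (rule card_le_two_constrained[where ?i1.0 = Al and ?i2.0 = Be' and ?i3.0 = Al' and ?i4.0 = Ga' and ?j1.0 = Be and ?j2.0 = Ga
          and ?R1.0 = "\<lambda>_. ?M" and ?R2.0 = "\<lambda>_. ?M"])
      (use M in \<open>auto simp: Z3_def box_def UNIV_index\<close>)
  moreover have "real (card Z1) \<le> real K ^ 4 * (K / p + 1)\<^sup>2"
  proof -
    define R1 where "R1 = (\<lambda>(a, a', b, g :: nat). {y \<in> {1..K}. \<not> p dvd a + a' \<and> p dvd (a + a') * y + a' * b})"
    define R2 where "R2 = (\<lambda>(a, a', b :: nat, g). {y \<in> {1..K}. \<not> p dvd a + a' \<and> p dvd (a + a') * y + a * g})"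
    have le: "real (card {y \<in> {1..K}. \<not> p dvd c \<and> p dvd c * y + d}) \<le> K / p + 1" for c d
      using card_residue_class_le_real[OF p, of c K d] by (cases "p dvd c") auto
    show ?thesis
    proof (rule card_le_two_constrained[where ?i1.0 = Al and ?i2.0 = Al' and ?i3.0 = Be and ?i4.0 = Ga and ?j1.0 = Be' and ?j2.0 = Ga'
          and ?R1.0 = R1 and ?R2.0 = R2])
      show "r Be' \<in> R1 (r Al, r Al', r Be, r Ga) \<and> r Ga' \<in> R2 (r Al, r Al', r Be, r Ga)" if "r \<in> Z1" for r
        using that by (simp add: Z1_def R1_def R2_def gen2 gen3 box_def add.commute)
    qed (use le in \<open>auto simp: R1_def R2_def Z1_def UNIV_index\<close>)
  qed
  ultimately show ?thesis using card by linarith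
qed

text \<open>The first of the three relations yields \<open>r Ga\<close>. Then \<open>gen3\<close>
  and \<open>gen2\<close> are linear in \<open>r Be'\<close> and \<open>r Ga'\<close> with positive
  coefficient.\<close>

lemma gens_determine:
  assumes "r \<in> box K" "gen1 r = gen1 s" "gen2 r = gen2 s" "gen3 r = gen3 s"
    and eq: "r Al = s Al" "r Al' = s Al'" "r Be = s Be"
  shows "r = s"
proof -
  have pos: "0 < r Al + r Al'" "0 < gen3 r" using assms(1) by (auto simp: box_def gen3_def Suc_le_eq)
  have rel: "(q Al + q Al') * gen1 q = q Be * gen2 q + q Ga * gen3 q" for q
    by (simp add: gen_defs algebra_simps)
  have "r Be * gen2 r + r Ga * gen3 r = r Be * gen2 r + s Ga * gen3 r"
    using rel[of r, symmetric] rel[of s] by (simp only: assms(2-4) eq)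
  then have "r Ga * gen3 r = s Ga * gen3 r" by simp
  then have Ga: "r Ga = s Ga" using pos by simp
  have "(r Al + r Al') * r Be' = (r Al + r Al') * s Be'"
    using assms(4) eq by (simp add: gen3_def algebra_simps)
  then have Be': "r Be' = s Be'" using pos by auto
  have "(r Al + r Al') * r Ga' = (r Al + r Al') * s Ga'"
    using assms(3) eq Ga by (simp add: gen2_def algebra_simps)
  then have Ga': "r Ga' = s Ga'" using pos by auto
  show ?thesis
  proof
    fix i show "r i = s i" using eq Ga Be' Ga' by (cases i) auto
  qed
qed

lemma gens_le:
  assumes "r \<in> box K"
  shows "gen1 r \<le> 3 * K\<^sup>2" "gen2 r \<le> 3 * K\<^sup>2" "gen3 r \<le> 3 * K\<^sup>2"
proof -
  have *: "r i * r j \<le> K\<^sup>2" for i j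
    using assms unfolding box_def power2_eq_square by (intro mult_le_mono) auto
  show "gen1 r \<le> 3 * K\<^sup>2" using *[of Be Ga] *[of Be Ga'] *[of Be' Ga] by (simp add: gen1_def)
  show "gen2 r \<le> 3 * K\<^sup>2" using *[of Al Ga] *[of Al Ga'] *[of Al' Ga'] by (simp add: gen2_def)
  show "gen3 r \<le> 3 * K\<^sup>2" using *[of Al Be'] *[of Al' Be] *[of Al' Be'] by (simp add: gen3_def)
qed

lemma gens_pos:
  assumes "\<And>i. 0 < r i"
  shows "0 < gen1 r" "0 < gen2 r" "0 < gen3 r"
  using assms by (simp_all add: gen_defs)

text \<open>Positivity excludes the quotient 0, so each quotient has at most
  \<open>3 * K\<^sup>2 / p\<close> values without a rounding term; such a term would spoil the
  estimate for large \<open>p\<close>.\<close>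

lemma card_gens_divisible_le_large:
  assumes "0 < p"
  shows "real (card {r \<in> box K. p dvd gen1 r \<and> p dvd gen2 r \<and> p dvd gen3 r}) \<le> 27 * real K ^ 9 * (1 / real p ^ 3)"
proof -
  let ?Z = "{r \<in> box K. p dvd gen1 r \<and> p dvd gen2 r \<and> p dvd gen3 r}"
  let ?m = "3 * K\<^sup>2 div p"
  let ?f = "\<lambda>r. (gen1 r div p, gen2 r div p, gen3 r div p, r Al, r Al', r Be)"
  have "inj_on ?f ?Z"
  proof (rule inj_onI)
    fix r s assume rs: "r \<in> ?Z" "s \<in> ?Z" "?f r = ?f s"
    then have "gen1 r = gen1 s" "gen2 r = gen2 s" "gen3 r = gen3 s" by (auto elim!: dvdE)
    then show "r = s" using gens_determine[of r K s] rs by simp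
  qed
  moreover have "?f ` ?Z \<subseteq> {1..?m} \<times> {1..?m} \<times> {1..?m} \<times> {1..K} \<times> {1..K} \<times> {1..K}"
  proof -
    have "1 \<le> n div p" if "p dvd n" "0 < n" for n
      using that assms by (simp add: dvd_imp_le div_greater_zero_iff Suc_le_eq)
    moreover have "0 < gen1 r \<and> 0 < gen2 r \<and> 0 < gen3 r" if "r \<in> box K" for r
      using that gens_pos[of r] by (simp add: box_def Suc_le_eq)
    ultimately show ?thesis using gens_le by (auto simp: div_le_mono) (auto simp: box_def)
  qed
  ultimately have "card ?Z \<le> card ({1..?m} \<times> {1..?m} \<times> {1..?m} \<times> {1..K} \<times> {1..K} \<times> {1..K})"
    by (rule card_inj_on_le) simp
  then have "real (card ?Z) \<le> real (?m ^ 3 * K ^ 3)"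
    unfolding of_nat_le_iff by (simp add: card_cartesian_product power3_eq_cube mult.assoc)
  also have "\<dots> = real ?m ^ 3 * real K ^ 3" by simp
  also have "\<dots> \<le> (real (3 * K\<^sup>2) / real p) ^ 3 * real K ^ 3"
    by (intro mult_right_mono power_mono real_div_le) auto
  also have "\<dots> = 27 * real K ^ 9 * (1 / real p ^ 3)"
    by (simp add: power_divide power_mult_distrib flip: power_add power_mult)
  finally show ?thesis .
qed

lemma square_plus_one_le: "(x + 1)\<^sup>2 \<le> 2 * x\<^sup>2 + (2 :: real)"
  using zero_le_power2[of "x - 1"] by (simp add: power2_eq_square algebra_simps)

text \<open>
  For \<open>p \<le> K\<^sup>2 / P\<close> two of the three congruences fix two entries modulo \<open>p\<close>. For larger \<open>p\<close> the quotients
  of the generators by \<open>p\<close> are few, and the generators and three entries determine the rest.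
\<close>

lemma card_large_common_prime_le:
  assumes P: "0 < P"
  shows "real (card {r \<in> box K. \<exists>p>P. prime p \<and> p dvd gen1 r \<and> p dvd gen2 r \<and> p dvd gen3 r})
    \<le> 18 * real K ^ 6 / P + 54 * (real P)\<^sup>2 * real K ^ 5"
proof -
  let ?Z = "{r \<in> box K. \<exists>p>P. prime p \<and> p dvd gen1 r \<and> p dvd gen2 r \<and> p dvd gen3 r}"
  \<comment> \<open>Up to \<open>T\<close> the rounding contributions \<open>6 * K ^ 4\<close> add
    up to \<open>6 * K ^ 6 / P\<close> at most; beyond \<open>T\<close> the tail of the inverse
    cubes turns \<open>K ^ 9\<close> into \<open>P\<^sup>2 * K ^ 5\<close>.\<close>
  define T where "T = K\<^sup>2 div P"
  define A where "A = {p \<in> {P<..T}. prime p}"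
  define B where "B = {T<..3 * K\<^sup>2}"
  define U where "U p = {r \<in> box K. p dvd gen2 r \<and> p dvd gen3 r}" for p
  define V where "V p = {r \<in> box K. p dvd gen1 r \<and> p dvd gen2 r \<and> p dvd gen3 r}" for p
  have fin: "finite A" "finite B" "finite (U p)" "finite (V p)" for p
    using finite_box[of K] by (simp_all add: A_def B_def U_def V_def)
  have "?Z \<subseteq> (\<Union>p\<in>A. U p) \<union> (\<Union>p\<in>B. V p)"
  proof clarify
    fix r p assume r: "r \<in> box K" "P < p" "prime p" "p dvd gen1 r" "p dvd gen2 r" "p dvd gen3 r"
      and n: "r \<notin> (\<Union>p\<in>B. V p)"
    have "0 < gen1 r" using r(1) gens_pos[of r] by (simp add: box_def Suc_le_eq)
    then have "p \<le> gen1 r" using r by (simp add: dvd_imp_le)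
    then have "p \<le> 3 * K\<^sup>2" using gens_le(1)[OF r(1)] by simp
    then have "p \<notin> B \<longrightarrow> p \<in> A" using r by (auto simp: A_def B_def)
    moreover have "p \<notin> B" using n r by (auto simp: V_def)
    ultimately show "r \<in> (\<Union>p\<in>A. U p)" using r by (auto simp: U_def)
  qed
  then have "card ?Z \<le> card ((\<Union>p\<in>A. U p) \<union> (\<Union>p\<in>B. V p))"
    using fin by (intro card_mono) auto
  also have "\<dots> \<le> (\<Sum>p\<in>A. card (U p)) + (\<Sum>p\<in>B. card (V p))"
    using fin by (intro order_trans[OF card_Un_le] add_mono card_UN_le)
  finally have "real (card ?Z) \<le> real ((\<Sum>p\<in>A. card (U p)) + (\<Sum>p\<in>B. card (V p)))"
    unfolding of_nat_le_iff .
  then have "real (card ?Z) \<le> (\<Sum>p\<in>A. real (card (U p))) + (\<Sum>p\<in>B. real (card (V p)))" by simp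
  moreover have "(\<Sum>p\<in>A. real (card (U p))) \<le> 18 * real K ^ 6 / P"
  proof -
    have "(\<Sum>p\<in>A. real (card (U p))) \<le> (\<Sum>p\<in>A. 6 * real K ^ 6 * (1 / real p ^ 2) + 6 * real K ^ 4)"
    proof (rule sum_mono)
      fix p assume "p \<in> A"
      then have "real (card (U p)) \<le> 3 * real K ^ 4 * (K / p + 1)\<^sup>2"
        unfolding U_def A_def using card_gens_divisible_le by auto
      also have "\<dots> \<le> 3 * real K ^ 4 * (2 * (K / p)\<^sup>2 + 2)"
        by (intro mult_left_mono square_plus_one_le) simp
      also have "\<dots> = 6 * real K ^ 6 * (1 / real p ^ 2) + 6 * real K ^ 4"
        by (simp add: distrib_left power_divide flip: power_add)
      finally show "real (card (U p)) \<le> 6 * real K ^ 6 * (1 / real p ^ 2) + 6 * real K ^ 4" .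
    qed
    also have "\<dots> = 6 * real K ^ 6 * (\<Sum>p\<in>A. 1 / real p ^ 2) + card A * (6 * real K ^ 4)"
      by (simp add: sum.distrib sum_distrib_left)
    also have "\<dots> \<le> 6 * real K ^ 6 * (2 / real P) + real T * (6 * real K ^ 4)"
    proof (intro add_mono mult_left_mono mult_right_mono)
      show "(\<Sum>p\<in>A. 1 / real p ^ 2) \<le> 2 / real P"
        using P fin by (intro sum_inverse_squares_le) (auto simp: A_def)
      have "card A \<le> card {1..T}" by (intro card_mono) (auto simp: A_def)
      then show "real (card A) \<le> real T" by simp
    qed auto
    also have "\<dots> \<le> 6 * real K ^ 6 * (2 / real P) + (real K ^ 2 / P) * (6 * real K ^ 4)"
      using real_div_le[of "K\<^sup>2" P] by (intro add_left_mono mult_right_mono) (auto simp: T_def)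
    also have "\<dots> = 18 * real K ^ 6 / P"
      by (simp add: field_simps flip: power_add)
    finally show ?thesis .
  qed
  moreover have "(\<Sum>p\<in>B. real (card (V p))) \<le> 54 * (real P)\<^sup>2 * real K ^ 5"
  proof (cases "K = 0")
    case True
    then show ?thesis by (simp add: B_def)
  next
    case False
    have "(\<Sum>p\<in>B. real (card (V p))) \<le> (\<Sum>p\<in>B. 27 * real K ^ 9 * (1 / real p ^ 3))"
      unfolding V_def by (intro sum_mono card_gens_divisible_le_large) (auto simp: B_def)
    also have "\<dots> \<le> 27 * real K ^ 9 * (2 / real (T + 1) ^ 2)"
      unfolding sum_distrib_left[symmetric]
      using fin by (intro mult_left_mono sum_inverse_cubes_le) (auto simp: B_def)
    also have "\<dots> \<le> 27 * real K ^ 9 * (2 / (real K ^ 2 / P) ^ 2)"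
    proof -
      have "K\<^sup>2 < (T + 1) * P" unfolding T_def using P by (simp add: dividend_less_div_times)
      then have "real (K\<^sup>2) < real ((T + 1) * P)" unfolding of_nat_less_iff .
      then have "real K ^ 2 / P \<le> real (T + 1)" using P by (simp add: field_simps)
      then show ?thesis using P False by (intro mult_left_mono divide_left_mono power_mono) auto
    qed
    also have "\<dots> = 54 * (real P)\<^sup>2 * real K ^ 5"
    proof -
      have "real K ^ 4 \<noteq> 0" using False by simp
      then show ?thesis using P by (simp add: power_divide nonzero_divide_eq_eq flip: power_mult power_add)
    qed
    finally show ?thesis .
  qed
  ultimately show ?thesis by linarith
qed

section \<open>Large entries\<close>

text \<open>
  The six parameters form a hexagon in which \<open>rot\<close> moves to the next vertex. The nine products in the three
  generators are those of the non-adjacent entries.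
\<close>

fun rot :: "index \<Rightarrow> index" where
  "rot Al = Al'" | "rot Al' = Ga" | "rot Ga = Ga'" | "rot Ga' = Be'" | "rot Be' = Be" | "rot Be = Al"

lemma nonadjacent_products_le:
  assumes "gen1 r \<le> N" "gen2 r \<le> N" "gen3 r \<le> N"
  shows "r i * r (rot (rot i)) \<le> N" "r i * r (rot (rot (rot i))) \<le> N" "r i * r (rot (rot (rot (rot i)))) \<le> N"
  using assms by (cases i; simp add: gen_defs mult.commute)+

lemma UNIV_rot: "(UNIV :: index set) =
    {i, rot i, rot (rot i), rot (rot (rot i)), rot (rot (rot (rot i))), rot (rot (rot (rot (rot i))))}"
  by (cases i) (auto simp: UNIV_index)

definition admissible :: "nat \<Rightarrow> (index \<Rightarrow> nat) set" where
  "admissible N = {r. (\<forall>i. 0 < r i) \<and> gen1 r \<le> N \<and> gen2 r \<le> N \<and> gen3 r \<le> N}"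

lemma admissible_entry_le:
  assumes "r \<in> admissible N"
  shows "r i \<le> N"
proof -
  have "r i * r (rot (rot i)) \<le> N" "0 < r (rot (rot i))"
    using assms nonadjacent_products_le[of r N i] by (auto simp: admissible_def)
  then show ?thesis by (metis One_nat_def Suc_leI le_trans mult_le_mono2 nat_mult_1_right)
qed

lemma finite_admissible: "finite (admissible N)"
  by (rule finite_subset[OF _ card_functions_into(1)[of "{..N}"]]) (auto simp: admissible_entry_le)

text \<open>One of the two factors is at most \<open>sqrt N\<close>, the other at most
  \<open>m\<close>.\<close>

lemma card_hyperbola_le:
  fixes N m :: nat
  shows
  "real (card {(x, y). x \<in> {1..m} \<and> y \<in> {1..m} \<and> x * y \<le> N}) \<le> 2 * sqrt N * m"
proof -
  define k where "k = nat \<lfloor>sqrt N\<rfloor>"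
  have k: "x \<le> k \<or> y \<le> k" if "x * y \<le> N" for x y
  proof (rule ccontr)
    assume "\<not> (x \<le> k \<or> y \<le> k)"
    then have "sqrt N < x" "sqrt N < y" unfolding k_def by linarith+
    then have "sqrt N * sqrt N < real x * real y" by (intro mult_strict_mono') auto
    then show False using that by (simp flip: of_nat_mult)
  qed
  have "{(x, y). x \<in> {1..m} \<and> y \<in> {1..m} \<and> x * y \<le> N} \<subseteq> {1..k} \<times> {1..m} \<union> {1..m} \<times> {1..k}"
  proof
    fix z assume "z \<in> {(x, y). x \<in> {1..m} \<and> y \<in> {1..m} \<and> x * y \<le> N}"
    then obtain x y where "z = (x, y)" "x \<in> {1..m}" "y \<in> {1..m}" "x * y \<le> N" by auto
    then show "z \<in> {1..k} \<times> {1..m} \<union> {1..m} \<times> {1..k}" using k[of x y] by auto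
  qed
  then have "card {(x, y). x \<in> {1..m} \<and> y \<in> {1..m} \<and> x * y \<le> N} \<le> card ({1..k} \<times> {1..m} \<union> {1..m} \<times> {1..k})"
    by (intro card_mono) auto
  also have "\<dots> \<le> card ({1..k} \<times> {1..m}) + card ({1..m} \<times> {1..k})" by (rule card_Un_le)
  finally have "real (card {(x, y). x \<in> {1..m} \<and> y \<in> {1..m} \<and> x * y \<le> N}) \<le> real (2 * k * m)"
    unfolding of_nat_le_iff by (simp add: algebra_simps)
  also have "\<dots> \<le> 2 * sqrt N * m" by (simp add: k_def mult_right_mono)
  finally show ?thesis .
qed

text \<open>
  If \<open>m\<close> is the largest entry, its three non-neighbours are at most \<open>N / m\<close>, and its two neighbours are at
  most \<open>m\<close> with product at most \<open>N\<close>.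
\<close>

lemma card_large_entry_le:
  fixes N :: nat and C :: real
  assumes C: "0 < C" and N: "0 < N"
  shows "real (card {r \<in> admissible N. \<exists>i. C * sqrt N < r i}) \<le> 24 * real N ^ 3 / C"
proof -
  \<comment> \<open>Vectors whose largest entry sits at \<open>i\<close>. Six positions with the
    bound \<open>4 * N ^ 3 / C\<close> each give the constant 24.\<close>
  define T where "T i = {r \<in> admissible N. C * sqrt N < r i \<and> (\<forall>j. r j \<le> r i)}" for i
  have bound: "real (card (T i)) \<le> 4 * real N ^ 3 / C" for i
  proof -
    define A where "A = {m \<in> {1..N}. C * sqrt N < real m}"
    define D where "D m = {(x, y). x \<in> {1..m} \<and> y \<in> {1..m} \<and> x * y \<le> N}" for m
    define R where "R m = ({1..N div m} \<times> {1..N div m} \<times> {1..N div m}) \<times> D m" for m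
    define f where "f r = (r i, (r (rot (rot i)), r (rot (rot (rot i))), r (rot (rot (rot (rot i))))),
      (r (rot i), r (rot (rot (rot (rot (rot i)))))))" for r :: "index \<Rightarrow> nat"
    have finD: "finite (D m)" for m
      by (rule finite_subset[of _ "{1..m} \<times> {1..m}"]) (auto simp: D_def)
    have fin: "finite A" "finite (R m)" for m by (simp_all add: A_def R_def finD)
    have "inj_on f (T i)"
    proof (rule inj_onI)
      fix r s assume eq: "f r = f s"
      show "r = s"
      proof
        fix j
        have "j \<in> {i, rot i, rot (rot i), rot (rot (rot i)), rot (rot (rot (rot i))), rot (rot (rot (rot (rot i))))}"
          unfolding UNIV_rot[symmetric] by simp
        then show "r j = s j" using eq by (auto simp: f_def)
      qed
    qed
    moreover have "f ` T i \<subseteq> (SIGMA m:A. R m)"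
    proof (rule image_subsetI)
      fix r assume r: "r \<in> T i"
      then have g: "gen1 r \<le> N" "gen2 r \<le> N" "gen3 r \<le> N" and pos: "0 < r j" for j
        by (auto simp: T_def admissible_def)
      have le: "r j \<le> r i" for j using r by (simp add: T_def)
      have div: "r j \<in> {1..N div r i}" if "r i * r j \<le> N" for j
        using that pos[of i] pos[of j] by (simp add: less_eq_div_iff_mult_less_eq mult.commute Suc_le_eq)
      have "r i \<in> A" using r pos[of i] admissible_entry_le[of r N i] by (simp add: T_def A_def Suc_le_eq)
      \<comment> \<open>The two neighbours of \<open>i\<close> are four steps of \<open>rot\<close>
        apart, hence not adjacent to each other.\<close>
      moreover have "r (rot i) * r (rot (rot (rot (rot (rot i))))) \<le> N"
        using nonadjacent_products_le(3)[OF g, of "rot i"] by simp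
      then have "(r (rot i), r (rot (rot (rot (rot (rot i)))))) \<in> D (r i)"
        using le pos by (simp add: D_def Suc_le_eq)
      ultimately show "f r \<in> (SIGMA m:A. R m)"
        unfolding f_def R_def using div nonadjacent_products_le[OF g, of i] by blast
    qed
    ultimately have "card (T i) \<le> card (SIGMA m:A. R m)"
      by (rule card_inj_on_le) (use fin in auto)
    also have "\<dots> = (\<Sum>m\<in>A. card (R m))" using fin by (simp add: card_SigmaI)
    finally have "real (card (T i)) \<le> real (\<Sum>m\<in>A. card (R m))" unfolding of_nat_le_iff .
    also have "\<dots> = (\<Sum>m\<in>A. real (card (R m)))" by simp
    also have "\<dots> \<le> (\<Sum>m\<in>A. 2 * sqrt N * real N ^ 3 * (1 / real m ^ 2))"
    proof (rule sum_mono)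
      fix m assume "m \<in> A"
      then have m: "0 < m" by (simp add: A_def)
      have "real (card (R m)) = real (N div m) ^ 3 * real (card (D m))"
        by (simp add: R_def card_cartesian_product power3_eq_cube mult.assoc)
      also have "\<dots> \<le> (N / m) ^ 3 * (2 * sqrt N * m)"
        unfolding D_def by (intro mult_mono power_mono real_div_le card_hyperbola_le) auto
      also have "\<dots> = 2 * sqrt N * real N ^ 3 * (1 / real m ^ 2)"
        using m by (simp add: power_divide power2_eq_square power3_eq_cube)
      finally show "real (card (R m)) \<le> 2 * sqrt N * real N ^ 3 * (1 / real m ^ 2)" .
    qed
    also have "\<dots> = 2 * sqrt N * real N ^ 3 * (\<Sum>m\<in>A. 1 / real m ^ 2)"
      by (simp add: sum_distrib_left)
    also have "\<dots> \<le> 2 * sqrt N * real N ^ 3 * (2 / (C * sqrt N))"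
    proof (intro mult_left_mono)
      define n where "n = nat \<lfloor>C * sqrt N\<rfloor> + 1"
      have n: "C * sqrt N \<le> n" unfolding n_def by linarith
      have "(\<Sum>m\<in>A. 1 / real m ^ 2) \<le> 2 / real n"
      proof (rule sum_inverse_squares_le[OF fin(1)])
        show "A \<subseteq> {n..}"
        proof
          fix m assume "m \<in> A"
          then have "\<lfloor>C * sqrt N\<rfloor> < int m" by (simp add: A_def floor_less_iff)
          moreover have "0 \<le> \<lfloor>C * sqrt N\<rfloor>" using C by simp
          ultimately have "nat \<lfloor>C * sqrt N\<rfloor> < m" by linarith
          then show "m \<in> {n..}" by (simp add: n_def)
        qed
      qed (simp add: n_def)
      also have "\<dots> \<le> 2 / (C * sqrt N)"
      proof (intro divide_left_mono n mult_pos_pos)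
        show "0 < real n" by (simp add: n_def)
      qed (use C N in auto)
      finally show "(\<Sum>m\<in>A. 1 / real m ^ 2) \<le> 2 / (C * sqrt N)" .
    qed simp
    also have "\<dots> = 4 * real N ^ 3 / C" using N by simp
    finally show ?thesis .
  qed
  have finT: "finite (T i)" for i using finite_admissible[of N] by (simp add: T_def)
  have "{r \<in> admissible N. \<exists>i. C * sqrt N < r i} \<subseteq> (\<Union>i\<in>UNIV. T i)"
  proof clarify
    fix r i assume r: "r \<in> admissible N" "C * sqrt N < r i"
    have "Max (range r) \<in> range r" by (rule Max_in) auto
    then obtain k where k: "Max (range r) = r k" by blast
    have le: "r j \<le> r k" for j unfolding k[symmetric] by (rule Max_ge) auto
    then have "C * sqrt N < r k" using r(2) le[of i] by linarith
    then show "r \<in> (\<Union>i\<in>UNIV. T i)" using r le unfolding T_def by blast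
  qed
  then have "card {r \<in> admissible N. \<exists>i. C * sqrt N < r i} \<le> card (\<Union>i\<in>UNIV. T i)"
    using finT by (intro card_mono) auto
  also have "\<dots> \<le> (\<Sum>i\<in>UNIV. card (T i))" by (rule card_UN_le) simp
  finally have "real (card {r \<in> admissible N. \<exists>i. C * sqrt N < r i}) \<le> real (\<Sum>i\<in>UNIV. card (T i))"
    unfolding of_nat_le_iff .
  also have "\<dots> = (\<Sum>i\<in>UNIV. real (card (T i)))" by simp
  also have "\<dots> \<le> (\<Sum>i\<in>(UNIV :: index set). 4 * real N ^ 3 / C)" by (intro sum_mono bound)
  also have "\<dots> = 24 * real N ^ 3 / C" by (simp add: card_index)
  finally show ?thesis .
qed

section \<open>Densities of primitive parameter vectors\<close>

text \<open>Lets the sieve level and the truncation depend on the tolerance without controlling the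
  limits of the approximations.\<close>

lemma convergent_if_approximable:
  fixes f :: "nat \<Rightarrow> real"
  assumes "\<And>\<epsilon>. 0 < \<epsilon> \<Longrightarrow> \<exists>g. convergent g \<and> (\<forall>\<^sub>F n in sequentially. \<bar>f n - g n\<bar> \<le> \<epsilon>)"
  shows "convergent f"
proof -
  have "Cauchy f"
  proof (rule metric_CauchyI)
    fix e :: real assume "0 < e"
    then obtain g where g: "convergent g" "\<forall>\<^sub>F n in sequentially. \<bar>f n - g n\<bar> \<le> e / 4"
      using assms[of "e / 4"] by auto
    obtain M1 where M1: "\<And>m n. M1 \<le> m \<Longrightarrow> M1 \<le> n \<Longrightarrow> dist (g m) (g n) < e / 4"
      using metric_CauchyD[OF convergent_Cauchy[OF g(1)], of "e / 4"] \<open>0 < e\<close> by auto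
    obtain M2 where M2: "\<And>n. M2 \<le> n \<Longrightarrow> \<bar>f n - g n\<bar> \<le> e / 4"
      using g(2) unfolding eventually_sequentially by blast
    have "dist (f m) (f n) < e" if "max M1 M2 \<le> m" "max M1 M2 \<le> n" for m n
    proof -
      have "\<bar>g m - g n\<bar> < e / 4" "\<bar>f m - g m\<bar> \<le> e / 4" "\<bar>f n - g n\<bar> \<le> e / 4"
        using M1[of m n] M2[of m] M2[of n] that by (simp_all add: dist_real_def)
      then show ?thesis using \<open>0 < e\<close> unfolding dist_real_def by linarith
    qed
    then show "\<exists>M. \<forall>m\<ge>M. \<forall>n\<ge>M. dist (f m) (f n) < e" by blast
  qed
  then show ?thesis by (rule Cauchy_convergent)
qed

lemma abs_ratio_diff_le:
  fixes x y b n :: real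
  assumes "y \<le> x" "x \<le> y + b" "0 < n"
  shows "\<bar>x / n - y / n\<bar> \<le> b / n"
proof -
  have "\<bar>x / n - y / n\<bar> = (x - y) / n" using assms by (simp add: divide_right_mono diff_divide_distrib)
  then show ?thesis using assms by (simp add: divide_right_mono)
qed

section \<open>Homogeneity and monotonicity of the counting region\<close>

lemma gens_scale:
  "gen1 (\<lambda>i. M * k i) = M\<^sup>2 * gen1 k" "gen2 (\<lambda>i. M * k i) = M\<^sup>2 * gen2 k"
  "gen3 (\<lambda>i. M * k i) = M\<^sup>2 * gen3 k"
  by (simp_all add: gen_defs power2_eq_square algebra_simps)

lemma frob_scale: "frob (\<lambda>i. M * k i) = M ^ 3 * frob k"
proof -
  have "frob (\<lambda>i. M * k i) = max (M ^ 3 * ((k Be + k Be') * gen2 k + k Ga * gen3 k)) (M ^ 3 * (k Be * gen2 k + (k Ga + k Ga') * gen3 k))"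
    unfolding frob_def gens_scale by (simp add: algebra_simps power2_eq_square power3_eq_cube)
  then show ?thesis unfolding frob_def by (simp add: nat_mult_max_right)
qed

lemma gens_mono:
  assumes "\<And>i. k i \<le> l i"
  shows "gen1 k \<le> gen1 l" "gen2 k \<le> gen2 l" "gen3 k \<le> gen3 l"
  unfolding gen_defs using assms by (intro add_mono mult_le_mono; simp)+

lemma frob_mono: "(\<And>i. k i \<le> l i) \<Longrightarrow> frob k \<le> frob l"
  unfolding frob_def by (intro max.mono add_mono mult_le_mono gens_mono) auto

text \<open>\<open>X\<close> plays the role of \<open>sqrt N\<close>. The factor \<open>h\<close> is
  a switch: \<open>h = 1\<close> imposes the bound on \<open>frob\<close>, while
  \<open>h = t = 0\<close> makes it void, so that the total count and the distribution function
  share one proof.\<close>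

definition region :: "real \<Rightarrow> real \<Rightarrow> real \<Rightarrow> real \<Rightarrow> (index \<Rightarrow> nat) \<Rightarrow> bool" where
  "region h t C X r \<longleftrightarrow> real (gen1 r) \<le> X\<^sup>2 \<and> real (gen2 r) \<le> X\<^sup>2 \<and> real (gen3 r) \<le> X\<^sup>2
     \<and> h * real (frob r) \<le> t * X ^ 3 \<and> (\<forall>i. real (r i) \<le> C * X)"

lemma growing_region_region:
  assumes "0 \<le> h" "0 \<le> t" "0 < C"
  shows "growing_region (region h t C) C 6"
proof
  fix M :: nat and X :: real and k :: "index \<Rightarrow> nat"
  assume M: "0 < M" "0 < X"
  have sq: "real M ^ 2 * real n \<le> X\<^sup>2 \<longleftrightarrow> n \<le> (X / M)\<^sup>2" for n
    using M by (simp add: power_divide field_simps)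
  have cube: "h * (real M ^ 3 * real n) \<le> t * X ^ 3 \<longleftrightarrow> h * n \<le> t * (X / M) ^ 3" for n
    using M by (simp add: power_divide field_simps)
  have lin: "real M * real n \<le> C * X \<longleftrightarrow> n \<le> C * (X / M)" for n
    using M by (simp add: field_simps)
  show "region h t C X (\<lambda>i. M * k i) \<longleftrightarrow> region h t C (X / M) k"
    unfolding region_def gens_scale frob_scale of_nat_mult of_nat_power sq cube lin ..
next
  fix X :: real and l k :: "index \<Rightarrow> nat"
  assume E: "region h t C X l" and le: "\<And>i. k i \<le> l i"
  have "h * real (frob k) \<le> h * real (frob l)" using frob_mono[OF le] assms by (intro mult_left_mono) auto
  moreover have "real (k i) \<le> real (l i)" for i using le by simp
  moreover have "real (gen1 k) \<le> gen1 l" "real (gen2 k) \<le> gen2 l" "real (gen3 k) \<le> gen3 l"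
    using gens_mono[OF le] by simp_all
  ultimately show "region h t C X k" using E unfolding region_def by (meson order_trans)
next
  fix X Y :: real and k :: "index \<Rightarrow> nat"
  assume X: "0 < X" "X \<le> Y" and E: "region h t C X k"
  have "X\<^sup>2 \<le> Y\<^sup>2" "t * X ^ 3 \<le> t * Y ^ 3" "C * X \<le> C * Y"
    using X assms by (intro power_mono mult_left_mono; simp)+
  then show "region h t C Y k" using E unfolding region_def by (meson order_trans)
next
  show "real (k i) \<le> C * X" if "region h t C X k" for X k i using that by (simp add: region_def)
qed (use assms card_index in auto)

section \<open>Sieving out common prime factors\<close>

definition sieved :: "nat \<Rightarrow> (index \<Rightarrow> nat) \<Rightarrow> bool" where
  "sieved P r \<longleftrightarrow> (\<forall>p\<le>P. prime p \<longrightarrow> \<not> (p dvd gen1 r \<and> p dvd gen2 r \<and> p dvd gen3 r))"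

definition primitive :: "(index \<Rightarrow> nat) \<Rightarrow> bool" where
  "primitive r \<longleftrightarrow> gcd (gen1 r) (gcd (gen2 r) (gen3 r)) = 1"

lemma primitive_imp_sieved: "primitive r \<Longrightarrow> sieved P r"
  unfolding primitive_def sieved_def by (metis gcd_greatest not_prime_unit)

lemma sieved_not_primitive:
  assumes "sieved P r" "\<not> primitive r"
  shows "\<exists>p>P. prime p \<and> p dvd gen1 r \<and> p dvd gen2 r \<and> p dvd gen3 r"
proof -
  obtain p where p: "prime p" "p dvd gcd (gen1 r) (gcd (gen2 r) (gen3 r))"
    using assms(2) prime_factor_nat unfolding primitive_def by blast
  then show ?thesis using assms(1) unfolding sieved_def by (metis gcd_nat.boundedE not_le)
qed

text \<open>The modulus \<open>fact P\<close> is divisible by every prime up to \<open>P\<close>,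
  and the generators are polynomials in the entries.\<close>

lemma sieved_periodic: "sieved P (\<lambda>i. r i + fact P * k i) \<longleftrightarrow> sieved P r"
proof -
  have "[gen1 (\<lambda>i. r i + fact P * k i) = gen1 r] (mod p) \<and> [gen2 (\<lambda>i. r i + fact P * k i) = gen2 r] (mod p)
     \<and> [gen3 (\<lambda>i. r i + fact P * k i) = gen3 r] (mod p)" if "prime p" "p \<le> P" for p
  proof -
    have "p dvd fact P" using that by (simp add: prime_dvd_fact_iff)
    then have "[r i + fact P * k i = r i] (mod p)" for i
      by (simp add: cong_def mod_add_eq[symmetric])
    then show ?thesis unfolding gen_defs by (intro conjI cong_add cong_mult)
  qed
  then have "p dvd gen1 (\<lambda>i. r i + fact P * k i) \<longleftrightarrow> p dvd gen1 r" "p dvd gen2 (\<lambda>i. r i + fact P * k i) \<longleftrightarrow> p dvd gen2 r"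
    "p dvd gen3 (\<lambda>i. r i + fact P * k i) \<longleftrightarrow> p dvd gen3 r" if "prime p" "p \<le> P" for p
    using that cong_dvd_iff by blast+
  then show ?thesis unfolding sieved_def by blast
qed

definition truncated :: "real \<Rightarrow> real \<Rightarrow> real \<Rightarrow> nat \<Rightarrow> (index \<Rightarrow> nat) set" where
  "truncated h t C N = {r \<in> admissible N. h * real (frob r) \<le> t * sqrt N ^ 3 \<and> (\<forall>i. r i \<le> C * sqrt N)}"

lemma finite_truncated: "finite (truncated h t C N)"
  using finite_admissible[of N] by (simp add: truncated_def)

lemma truncated_eq: "truncated h t C N = {r. (\<forall>i. 0 < r i) \<and> region h t C (sqrt N) r}"
  by (auto simp: truncated_def admissible_def region_def)

lemma sqrt_power6: "sqrt (real N) ^ 6 = real N ^ 3"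
  using power_mult[of "sqrt (real N)" 2 3] by simp

lemma convergent_truncated_sieved:
  assumes "0 \<le> h" "0 \<le> t" "0 < C"
  shows "convergent (\<lambda>N. card {r \<in> truncated h t C N. sieved P r} / real N ^ 3)"
proof -
  interpret growing_region "region h t C" C 6 using assms by (rule growing_region_region)
  obtain L where L: "((\<lambda>X. card {r. (\<forall>i. 0 < r i) \<and> region h t C X r \<and> sieved P r} / X ^ 6) \<longlongrightarrow> L) at_top"
    using periodic_density[of "fact P" "sieved P"] sieved_periodic by auto
  have "filterlim (\<lambda>N. sqrt (real N)) at_top sequentially"
    by real_asymp
  from filterlim_compose[OF L this]
  have "(\<lambda>N. card {r. (\<forall>i. 0 < r i) \<and> region h t C (sqrt N) r \<and> sieved P r} / real N ^ 3) \<longlonglongrightarrow> L"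
    unfolding sqrt_power6 .
  moreover have "{r. (\<forall>i. 0 < r i) \<and> region h t C (sqrt N) r \<and> sieved P r} = {r \<in> truncated h t C N. sieved P r}" for N
    unfolding truncated_eq by auto
  ultimately show ?thesis by (auto simp: convergent_def)
qed

lemma convergent_truncated_primitive:
  assumes "0 \<le> h" "0 \<le> t" "0 < C"
  shows "convergent (\<lambda>N. card {r \<in> truncated h t C N. primitive r} / real N ^ 3)"
proof (rule convergent_if_approximable)
  fix e :: real assume "0 < e"
  \<comment> \<open>Makes the part \<open>18 * C ^ 6 / P\<close> of the sieve error at most
    \<open>e / 2\<close>; the other part decays like \<open>1 / sqrt N\<close> once \<open>P\<close>
    is fixed.\<close>
  define P where "P = nat \<lceil>36 * C ^ 6 / e\<rceil> + 1"
  have P: "0 < P" "36 * C ^ 6 / e \<le> P" unfolding P_def by (simp, linarith)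
  let ?g = "\<lambda>N. card {r \<in> truncated h t C N. sieved P r} / real N ^ 3"
  let ?f = "\<lambda>N. card {r \<in> truncated h t C N. primitive r} / real N ^ 3"
  have "(\<lambda>N. 54 * (real P)\<^sup>2 * C ^ 5 / sqrt (real N)) \<longlonglongrightarrow> 0" by real_asymp
  then have "\<forall>\<^sub>F N in sequentially. 54 * (real P)\<^sup>2 * C ^ 5 / sqrt (real N) < e / 2"
    using \<open>0 < e\<close> by (intro order_tendstoD) auto
  then have "\<forall>\<^sub>F N in sequentially. \<bar>?f N - ?g N\<bar> \<le> e"
    using eventually_gt_at_top[of 0]
  proof eventually_elim
    case (elim N)
    define K where "K = nat \<lfloor>C * sqrt N\<rfloor>"
    have K: "real K \<le> C * sqrt N" using assms by (simp add: K_def)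
    let ?B = "{r \<in> box K. \<exists>p>P. prime p \<and> p dvd gen1 r \<and> p dvd gen2 r \<and> p dvd gen3 r}"
    have sub: "{r \<in> truncated h t C N. primitive r} \<subseteq> {r \<in> truncated h t C N. sieved P r}"
      using primitive_imp_sieved by auto
    have "{r \<in> truncated h t C N. sieved P r} \<subseteq> {r \<in> truncated h t C N. primitive r} \<union> ?B"
    proof
      fix r assume r: "r \<in> {r \<in> truncated h t C N. sieved P r}"
      then have "r \<in> box K" by (auto simp: truncated_def admissible_def box_def K_def le_nat_floor Suc_le_eq)
      then show "r \<in> {r \<in> truncated h t C N. primitive r} \<union> ?B"
        using r sieved_not_primitive[of P r] by blast
    qed
    then have "card {r \<in> truncated h t C N. sieved P r} \<le> card ({r \<in> truncated h t C N. primitive r} \<union> ?B)"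
      using finite_truncated finite_box by (intro card_mono) auto
    also have "\<dots> \<le> card {r \<in> truncated h t C N. primitive r} + card ?B" by (rule card_Un_le)
    finally have "real (card {r \<in> truncated h t C N. sieved P r}) \<le> card {r \<in> truncated h t C N. primitive r} + real (card ?B)"
      by linarith
    moreover have "card {r \<in> truncated h t C N. primitive r} \<le> card {r \<in> truncated h t C N. sieved P r}"
      using sub finite_truncated by (intro card_mono) auto
    ultimately have "\<bar>?f N - ?g N\<bar> \<le> card ?B / real N ^ 3"
      using elim by (subst abs_minus_commute) (intro abs_ratio_diff_le; simp)
    also have "\<dots> \<le> (18 * real K ^ 6 / P + 54 * (real P)\<^sup>2 * real K ^ 5) / real N ^ 3"
      using card_large_common_prime_le[OF P(1), of K] by (intro divide_right_mono) auto
    also have "\<dots> \<le> (18 * (C * sqrt N) ^ 6 / P + 54 * (real P)\<^sup>2 * (C * sqrt N) ^ 5) / sqrt N ^ 6"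
      unfolding sqrt_power6 using K by (intro divide_right_mono add_mono mult_left_mono power_mono) auto
    also have "\<dots> = 18 * C ^ 6 / P + 54 * (real P)\<^sup>2 * C ^ 5 / sqrt N"
    proof -
      have "sqrt N ^ 6 = sqrt N ^ 5 * sqrt N" by (simp add: numeral_eq_Suc)
      moreover have "sqrt N \<noteq> 0" using elim by simp
      ultimately show ?thesis by (simp add: add_divide_distrib power_mult_distrib)
    qed
    also have "18 * C ^ 6 / P \<le> e / 2"
      using P \<open>0 < e\<close> by (simp add: field_simps)
    finally show ?case using elim by linarith
  qed
  then show "\<exists>g. convergent g \<and> (\<forall>\<^sub>F N in sequentially. \<bar>?f N - g N\<bar> \<le> e)"
    using convergent_truncated_sieved[OF assms] by blast
qed

section \<open>Removing the truncation\<close>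

definition primitive_ratio :: "real \<Rightarrow> real \<Rightarrow> nat \<Rightarrow> real" where
  "primitive_ratio h t N = card {r \<in> admissible N. primitive r \<and> h * real (frob r) \<le> t * sqrt N ^ 3} / real N ^ 3"

lemma convergent_primitive_ratio_nonneg:
  assumes "0 \<le> h" "0 \<le> t"
  shows "convergent (primitive_ratio h t)"
proof (rule convergent_if_approximable)
  fix e :: real assume "0 < e"
  define C where "C = 24 / e"
  have C: "0 < C" using \<open>0 < e\<close> by (simp add: C_def)
  let ?g = "\<lambda>N. card {r \<in> truncated h t C N. primitive r} / real N ^ 3"
  have "\<forall>\<^sub>F N in sequentially. \<bar>primitive_ratio h t N - ?g N\<bar> \<le> e"
    using eventually_gt_at_top[of 0]
  proof eventually_elim
    case (elim N)
    let ?A = "{r \<in> admissible N. primitive r \<and> h * real (frob r) \<le> t * sqrt N ^ 3}"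
    let ?T = "{r \<in> truncated h t C N. primitive r}"
    let ?B = "{r \<in> admissible N. \<exists>i. C * sqrt N < r i}"
    have fin: "finite ?A" "finite ?T" "finite ?B" using finite_admissible[of N] by (simp_all add: truncated_def)
    have "card ?A \<le> card (?T \<union> ?B)"
      using fin by (intro card_mono) (auto simp: truncated_def not_less)
    also have "\<dots> \<le> card ?T + card ?B" by (rule card_Un_le)
    finally have "real (card ?A) \<le> real (card ?T) + real (card ?B)" by linarith
    moreover have "card ?T \<le> card ?A"
      using fin by (intro card_mono) (auto simp: truncated_def)
    ultimately have "\<bar>primitive_ratio h t N - ?g N\<bar> \<le> card ?B / real N ^ 3"
      unfolding primitive_ratio_def using elim by (intro abs_ratio_diff_le; simp)
    also have "\<dots> \<le> (24 * real N ^ 3 / C) / real N ^ 3"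
      using card_large_entry_le[OF C elim] by (intro divide_right_mono) auto
    also have "\<dots> = e" using elim \<open>0 < e\<close> by (simp add: C_def)
    finally show ?case .
  qed
  then show "\<exists>g. convergent g \<and> (\<forall>\<^sub>F N in sequentially. \<bar>primitive_ratio h t N - g N\<bar> \<le> e)"
    using convergent_truncated_primitive[OF assms C] by blast
qed

lemma primitive_ratio_neg:
  assumes "t < 0"
  shows "primitive_ratio 1 t N = 0"
proof (cases "N = 0")
  case False
  have "\<not> 1 * real (frob r) \<le> t * sqrt N ^ 3" for r
  proof -
    have "t * sqrt N ^ 3 < 0" using assms False by (simp add: mult_neg_pos)
    then show ?thesis by (smt (verit) mult_1 of_nat_0_le_iff)
  qed
  then show ?thesis by (simp add: primitive_ratio_def)
qed (simp add: primitive_ratio_def)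

lemma convergent_primitive_ratio: "convergent (primitive_ratio 1 t)"
proof (cases "0 \<le> t")
  case False
  then have "primitive_ratio 1 t = (\<lambda>_. 0)" using primitive_ratio_neg by auto
  then show ?thesis by (simp add: convergent_const)
qed (simp add: convergent_primitive_ratio_nonneg)

text \<open>Each branch of the maximum is a sum of three products of an entry with a
  generator.\<close>

lemma frob_le:
  assumes r: "r \<in> admissible N" and le: "\<And>i. r i \<le> C * sqrt N"
  shows "frob r \<le> 3 * C * sqrt N ^ 3"
proof -
  have g: "real (gen2 r) \<le> sqrt N ^ 2" "real (gen3 r) \<le> sqrt N ^ 2" using r by (simp_all add: admissible_def)
  have "0 \<le> C * sqrt N" using order_trans[OF of_nat_0_le_iff le] .
  then have m: "real (r i) * gen2 r \<le> C * sqrt N * sqrt N ^ 2" "real (r i) * gen3 r \<le> C * sqrt N * sqrt N ^ 2" for i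
    using g le by (intro mult_mono; simp)+
  have "real (frob r) \<le> 3 * (C * sqrt N * sqrt N ^ 2)"
    unfolding frob_def of_nat_max using m[of Be] m[of Be'] m[of Ga] m[of Ga'] by (simp add: distrib_right)
  then show ?thesis by (simp add: power2_eq_square power3_eq_cube mult_ac)
qed

lemma primitive_ratio_mono: "t \<le> s \<Longrightarrow> primitive_ratio 1 t N \<le> primitive_ratio 1 s N"
  unfolding primitive_ratio_def
proof (intro divide_right_mono of_nat_mono card_mono)
  assume "t \<le> s"
  then have "t * sqrt N ^ 3 \<le> s * sqrt N ^ 3" by (simp add: mult_right_mono)
  then show "{r \<in> admissible N. primitive r \<and> 1 * real (frob r) \<le> t * sqrt N ^ 3} \<subseteq> {r \<in> admissible N. primitive r \<and> 1 * real (frob r) \<le> s * sqrt N ^ 3}"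
    by auto
qed (use finite_admissible in auto)

lemma primitive_ratio_le_total: "primitive_ratio 1 t N \<le> primitive_ratio 0 0 N"
  unfolding primitive_ratio_def
  by (intro divide_right_mono of_nat_mono card_mono) (use finite_admissible in auto)

text \<open>Tightness: by \<open>frob_le\<close>, a value of \<open>frob\<close> above the threshold
  forces an entry above \<open>C * sqrt N\<close>, and such vectors are rare uniformly in
  \<open>N\<close>.\<close>

lemma primitive_ratio_tail:
  assumes "0 < C" "3 * C \<le> t" "0 < N"
  shows "primitive_ratio 0 0 N - 24 / C \<le> primitive_ratio 1 t N"
proof -
  let ?A = "{r \<in> admissible N. primitive r \<and> 1 * real (frob r) \<le> t * sqrt N ^ 3}"
  let ?T = "{r \<in> admissible N. primitive r \<and> 0 * real (frob r) \<le> 0 * sqrt N ^ 3}"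
  let ?B = "{r \<in> admissible N. \<exists>i. C * sqrt N < r i}"
  have fin: "finite ?A" "finite ?T" "finite ?B" using finite_admissible[of N] by simp_all
  have "frob r \<le> t * sqrt N ^ 3" if "r \<in> admissible N" "\<And>i. r i \<le> C * sqrt N" for r
    using frob_le[OF that] mult_right_mono[OF assms(2), of "sqrt N ^ 3"] by simp
  then have "?T \<subseteq> ?A \<union> ?B" by (auto simp: not_less)
  then have "card ?T \<le> card (?A \<union> ?B)" using fin by (intro card_mono) auto
  also have "\<dots> \<le> card ?A + card ?B" by (rule card_Un_le)
  finally have "real (card ?T) \<le> real (card ?A) + real (card ?B)" by linarith
  also have "real (card ?B) \<le> 24 * real N ^ 3 / C" using card_large_entry_le assms by blast
  finally have "real (card ?T) / real N ^ 3 \<le> (real (card ?A) + 24 * real N ^ 3 / C) / real N ^ 3"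
    by (intro divide_right_mono) auto
  also have "\<dots> = real (card ?A) / real N ^ 3 + 24 / C" using assms by (simp add: add_divide_distrib)
  finally show ?thesis unfolding primitive_ratio_def by simp
qed

section \<open>The limiting distribution\<close>

text \<open>\<open>G\<close> need not be right-continuous, so the limit law is built from its
  right-continuous regularisation \<open>R\<close>. The two differ by an arbitrarily small shift
  only: \<open>R y \<le> G x \<le> R x\<close> for \<open>y < x\<close>.\<close>

lemma weak_limit_if_sandwiched:
  fixes \<mu> :: "nat \<Rightarrow> real measure" and G :: "real \<Rightarrow> real"
  assumes mono: "\<And>x y. x \<le> y \<Longrightarrow> G x \<le> G y"
    and bot: "(G \<longlongrightarrow> 0) at_bot" and top: "(G \<longlongrightarrow> 1) at_top"
    and lower: "\<And>t \<epsilon>. 0 < \<epsilon> \<Longrightarrow> \<forall>\<^sub>F n in sequentially. G t - \<epsilon> \<le> cdf (\<mu> n) t"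
    and upper: "\<And>t s \<epsilon>. t < s \<Longrightarrow> 0 < \<epsilon> \<Longrightarrow> \<forall>\<^sub>F n in sequentially. cdf (\<mu> n) t \<le> G s + \<epsilon>"
  shows "\<exists>M. real_distribution M \<and> weak_conv_m \<mu> M"
proof -
  define R where "R t = Inf (G ` {t<..})" for t
  have bdd: "bdd_below (G ` {t<..})" for t by (rule bdd_belowI2[of _ "G t"]) (simp add: mono)
  have R_le: "R t \<le> G s" if "t < s" for t s
    unfolding R_def using that bdd by (intro cInf_lower) auto
  have le_R: "c \<le> R t" if "\<And>s. t < s \<Longrightarrow> c \<le> G s" for c t
    unfolding R_def using that gt_ex[of t] by (intro cInf_greatest) auto
  have G_le_R: "G t \<le> R t" for t using mono by (intro le_R) simp
  have mono_R: "R x \<le> R y" if "x \<le> y" for x y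
    using that by (intro le_R R_le) simp
  have less_R: "\<exists>s>t. G s < u" if "R t < u" for t u
    using le_R[of t u] that by (meson not_le)
  have right_cont: "continuous (at_right a) R" for a
    unfolding continuous_within
  proof (rule order_tendstoI)
    fix l assume "l < R a"
    then show "\<forall>\<^sub>F x in at_right a. l < R x"
      using mono_R by (intro eventually_at_rightI[of a "a + 1"]) (auto intro: less_le_trans)
  next
    fix u assume "R a < u"
    then obtain s where s: "a < s" "G s < u" using less_R by blast
    then show "\<forall>\<^sub>F x in at_right a. R x < u"
      using R_le by (intro eventually_at_rightI[of a s]) (auto intro: le_less_trans)
  qed
  have R_bot: "(R \<longlongrightarrow> 0) at_bot"
  proof (rule tendsto_sandwich[OF _ _ bot])
    have "filterlim (\<lambda>x :: real. x + 1) at_bot at_bot" by real_asymp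
    then show "((\<lambda>x. G (x + 1)) \<longlongrightarrow> 0) at_bot" by (rule filterlim_compose[OF bot])
  qed (use G_le_R R_le in auto)
  have R_top: "(R \<longlongrightarrow> 1) at_top"
  proof (rule tendsto_sandwich[OF _ _ top])
    have "filterlim (\<lambda>x :: real. x + 1) at_top at_top" by real_asymp
    then show "((\<lambda>x. G (x + 1)) \<longlongrightarrow> 1) at_top" by (rule filterlim_compose[OF top])
  qed (use G_le_R R_le in auto)
  have cdf: "cdf (interval_measure R) = R"
    using mono_R right_cont R_bot by (rule cdf_interval_measure)
  have "(\<lambda>n. cdf (\<mu> n) x) \<longlonglongrightarrow> R x" if cont: "isCont R x" for x
  proof (rule order_tendstoI)
    fix l assume "l < R x"
    then have "\<forall>\<^sub>F y in at_left x. l < R y"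
      using cont by (intro order_tendstoD(1)[of R "R x"]) (auto simp: continuous_at filterlim_at_split)
    then obtain b where b: "b < x" "\<And>y. b < y \<Longrightarrow> y < x \<Longrightarrow> l < R y"
      unfolding eventually_at_left_field by blast
    \<comment> \<open>The hypothesis \<open>lower\<close> speaks of \<open>G\<close>, so a point
      left of \<open>x\<close> is needed where \<open>R\<close> is still above \<open>l\<close>:
      there \<open>R\<close> is at most \<open>G x\<close>.\<close>
    then have "l < R ((b + x) / 2)" "R ((b + x) / 2) \<le> G x" using R_le by auto
    then have "0 < (G x - l) / 2" by simp
    from lower[OF this, of x] show "\<forall>\<^sub>F n in sequentially. l < cdf (\<mu> n) x"
      by eventually_elim (use \<open>0 < (G x - l) / 2\<close> in \<open>simp add: field_simps\<close>)
  next
    fix u assume "R x < u"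
    then obtain s where s: "x < s" "G s < u" using less_R by blast
    then have "0 < (u - G s) / 2" by simp
    from upper[OF s(1) this] show "\<forall>\<^sub>F n in sequentially. cdf (\<mu> n) x < u"
      by eventually_elim (use \<open>0 < (u - G s) / 2\<close> in \<open>simp add: field_simps\<close>)
  qed
  then have "weak_conv_m \<mu> (interval_measure R)"
    by (simp add: weak_conv_m_def weak_conv_def cdf)
  moreover have "real_distribution (interval_measure R)"
    using mono_R right_cont R_bot R_top by (rule real_distribution_interval_measure)
  ultimately show ?thesis by blast
qed

section \<open>Passage from parameter vectors to coprime triples\<close>

definition gens :: "(index \<Rightarrow> nat) \<Rightarrow> nat \<times> nat \<times> nat" where
  "gens r = (gen1 r, gen2 r, gen3 r)"

lemma johnson_data_gens:
  assumes "\<And>i. 0 < r i" "primitive r"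
  shows "johnson_data (r Al) (r Al') (r Be) (r Be') (r Ga) (r Ga') (gen1 r) (gen2 r) (gen3 r)"
  using assms by unfold_locales (simp_all add: gen_defs primitive_def)

lemma frobenius_number_gens:
  assumes "\<And>i. 0 < r i" "primitive r"
  shows "frobenius_number (gens r) = int (frob r) - int (gen1 r + gen2 r + gen3 r)"
  unfolding gens_def frob_def by (rule johnson_data.frobenius_number_eq[OF johnson_data_gens[OF assms]])

lemma inj_on_gens: "inj_on gens {r. (\<forall>i. 0 < r i) \<and> primitive r}"
proof (rule inj_onI)
  fix r s assume r: "r \<in> {r. (\<forall>i. 0 < r i) \<and> primitive r}" and s: "s \<in> {r. (\<forall>i. 0 < r i) \<and> primitive r}"
    and "gens r = gens s"
  then have eq: "gen1 r = gen1 s" "gen2 r = gen2 s" "gen3 r = gen3 s" by (simp_all add: gens_def)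
  have R: "johnson_data (r Al) (r Al') (r Be) (r Be') (r Ga) (r Ga') (gen1 r) (gen2 r) (gen3 r)"
    and S: "johnson_data (s Al) (s Al') (s Be) (s Be') (s Ga) (s Ga') (gen1 r) (gen2 r) (gen3 r)"
    using r s johnson_data_gens[of r] johnson_data_gens[of s] unfolding eq by auto
  show "r = s"
  proof
    fix i show "r i = s i" using johnson_data_unique[OF R S] by (cases i) auto
  qed
qed

lemma coprime_triples_subset: "coprime_triples N \<subseteq> {1..N} \<times> {1..N} \<times> {1..N}"
  by (auto simp: coprime_triples_def)

lemma finite_coprime_triples: "finite (coprime_triples N)"
  by (rule finite_subset[OF coprime_triples_subset]) simp

lemma gens_in_coprime_triples:
  assumes "r \<in> admissible N" "primitive r"
  shows "gens r \<in> coprime_triples N"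
  using assms gens_pos[of r] by (simp add: admissible_def primitive_def gens_def coprime_triples_def Suc_le_eq)

lemma nondegenerate_in_gens_image:
  assumes "a \<in> coprime_triples N" "\<not> degenerate a"
  shows "a \<in> gens ` {r \<in> admissible N. primitive r}"
proof -
  obtain a1 a2 a3 where a: "a = (a1, a2, a3)" by (cases a) auto
  have *: "0 < a1" "0 < a2" "0 < a3" "a1 \<le> N" "a2 \<le> N" "a3 \<le> N" "gcd a1 (gcd a2 a3) = 1"
    using assms(1) by (auto simp: a coprime_triples_def)
  obtain x x' y y' z z' where J: "johnson_data x x' y y' z z' a1 a2 a3"
    using johnson_data_exists[OF *(1-3,7)] assms(2) a by blast
  define r where "r i = (case i of Al \<Rightarrow> x | Al' \<Rightarrow> x' | Be \<Rightarrow> y | Be' \<Rightarrow> y' | Ga \<Rightarrow> z | Ga' \<Rightarrow> z')" for i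
  interpret johnson_data x x' y y' z z' a1 a2 a3 by fact
  have g: "gen1 r = a1" "gen2 r = a2" "gen3 r = a3"
    by (simp_all add: gen_defs r_def a1 a2 a3)
  have "0 < r i" for i using pos by (cases i) (simp_all add: r_def)
  then have "r \<in> admissible N" "primitive r"
    using * by (simp_all add: admissible_def primitive_def g)
  moreover have "gens r = a" by (simp add: gens_def g a)
  ultimately show ?thesis by blast
qed

definition degenerate_ratio :: "nat \<Rightarrow> real" where
  "degenerate_ratio N = card {a \<in> coprime_triples N. degenerate a} / real N ^ 3"

text \<open>\<open>gens\<close> is injective on primitive positive vectors, and its image misses
  only degenerate triples. The property is arbitrary so that the same bounds serve the distribution
  function and the total number of triples.\<close>

lemma card_triples_bounds:
  shows "card {r \<in> admissible N. primitive r \<and> \<Phi> (gens r)} \<le> card {a \<in> coprime_triples N. \<Phi> a}"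
    and "card {a \<in> coprime_triples N. \<Phi> a}
      \<le> card {r \<in> admissible N. primitive r \<and> \<Phi> (gens r)} + card {a \<in> coprime_triples N. degenerate a}"
proof -
  let ?A = "{r \<in> admissible N. primitive r \<and> \<Phi> (gens r)}"
  have fin: "finite ?A" "finite {a \<in> coprime_triples N. \<Psi> a}" for \<Psi>
    using finite_admissible finite_coprime_triples by simp_all
  have inj: "inj_on gens ?A"
    by (rule inj_on_subset[OF inj_on_gens]) (auto simp: admissible_def)
  have "gens ` ?A \<subseteq> {a \<in> coprime_triples N. \<Phi> a}" using gens_in_coprime_triples by auto
  then show "card ?A \<le> card {a \<in> coprime_triples N. \<Phi> a}"
    by (rule card_inj_on_le[OF inj _ fin(2)])
  have "{a \<in> coprime_triples N. \<Phi> a} \<subseteq> gens ` ?A \<union> {a \<in> coprime_triples N. degenerate a}"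
    using nondegenerate_in_gens_image by blast
  then have "card {a \<in> coprime_triples N. \<Phi> a} \<le> card (gens ` ?A \<union> {a \<in> coprime_triples N. degenerate a})"
    using fin by (intro card_mono) auto
  also have "\<dots> \<le> card (gens ` ?A) + card {a \<in> coprime_triples N. degenerate a}" by (rule card_Un_le)
  finally show "card {a \<in> coprime_triples N. \<Phi> a} \<le> card ?A + card {a \<in> coprime_triples N. degenerate a}"
    by (simp add: card_image inj)
qed

lemma degenerate_ratio_tendsto: "degenerate_ratio \<longlonglongrightarrow> 0"
proof (rule tendsto_sandwich[OF _ _ tendsto_const])
  let ?D = "\<lambda>N. {(a, b, c). a \<in> {1..N} \<and> b \<in> {1..N} \<and> c \<in> {1..N} \<and> glued a b c}"
  have "degenerate_ratio N \<le> 3 * (card (?D N) / real N ^ 3)" for N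
  proof -
    have fin: "finite (?D N)" by (rule finite_subset[of _ "{1..N} \<times> {1..N} \<times> {1..N}"]) auto
    have "{a \<in> coprime_triples N. degenerate a}
        \<subseteq> ?D N \<union> ((\<lambda>(b, c, a). (a, b, c)) ` ?D N \<union> (\<lambda>(c, a, b). (a, b, c)) ` ?D N)"
      unfolding degenerate_def coprime_triples_def by (force simp: image_iff)
    then have "card {a \<in> coprime_triples N. degenerate a}
        \<le> card (?D N \<union> ((\<lambda>(b, c, a). (a, b, c)) ` ?D N \<union> (\<lambda>(c, a, b). (a, b, c)) ` ?D N))"
      using fin by (intro card_mono) auto
    also have "\<dots> \<le> card (?D N) + (card ((\<lambda>(b, c, a). (a, b, c)) ` ?D N) + card ((\<lambda>(c, a, b). (a, b, c)) ` ?D N))"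
      by (meson add_left_mono card_Un_le le_trans)
    also have "\<dots> \<le> card (?D N) + (card (?D N) + card (?D N))"
      using fin by (intro add_mono card_image_le order_refl)
    finally have "real (card {a \<in> coprime_triples N. degenerate a}) \<le> 3 * real (card (?D N))" by linarith
    then have "degenerate_ratio N \<le> 3 * real (card (?D N)) / real N ^ 3"
      unfolding degenerate_ratio_def by (intro divide_right_mono) auto
    then show ?thesis by simp
  qed
  then show "\<forall>\<^sub>F N in sequentially. degenerate_ratio N \<le> 3 * (card (?D N) / real N ^ 3)" by simp
  show "(\<lambda>N. 3 * (card (?D N) / real N ^ 3)) \<longlonglongrightarrow> 0"
    using tendsto_mult_right_zero[OF glued_negligible, of 3] by simp
qed (simp add: degenerate_ratio_def)

definition triple_ratio :: "nat \<Rightarrow> real" where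
  "triple_ratio N = card (coprime_triples N) / real N ^ 3"

text \<open>Union bound over the common divisors \<open>d \<ge> 2\<close>, with the inverse cubes
  summing to at most 1/2. It keeps the normalising density away from 0.\<close>

lemma triple_ratio_ge:
  assumes "0 < N"
  shows "1 / 2 \<le> triple_ratio N"
proof -
  let ?B = "{1..N} \<times> {1..N} \<times> {1..N}"
  define U where "U = (\<Union>d\<in>{2..N}. (\<lambda>(x, y, z). (d * x, d * y, d * z)) ` ({1..N div d} \<times> {1..N div d} \<times> {1..N div d}))"
  have finU: "finite U" by (simp add: U_def)
  have "?B \<subseteq> coprime_triples N \<union> U"
  proof
    fix a assume a: "a \<in> ?B"
    obtain x y z where xyz: "a = (x, y, z)" by (cases a) auto
    define d where "d = gcd x (gcd y z)"
    have dvd: "d dvd x" "d dvd y" "d dvd z"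
      unfolding d_def by (meson dvd_trans gcd_dvd1 gcd_dvd2)+
    have pos: "0 < x" "0 < y" "0 < z" "x \<le> N" "y \<le> N" "z \<le> N" using a by (auto simp: xyz)
    show "a \<in> coprime_triples N \<union> U"
    proof (cases "d = 1")
      case True
      then show ?thesis using a by (simp add: xyz coprime_triples_def d_def)
    next
      case False
      have "0 < d" using pos by (simp add: d_def)
      then have "2 \<le> d" using False by simp
      moreover have "d \<le> N" using dvd(1) pos by (meson dvd_imp_le le_trans)
      moreover have "m = d * (m div d) \<and> m div d \<in> {1..N div d}" if "d dvd m" "0 < m" "m \<le> N" for m
        using that \<open>0 < d\<close> by (auto simp: div_le_mono div_greater_zero_iff dvd_imp_le Suc_le_eq)
      ultimately have "a \<in> U" unfolding U_def xyz using dvd pos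
        by (intro UN_I[of d] image_eqI[of _ _ "(x div d, y div d, z div d)"]) auto
      then show ?thesis by simp
    qed
  qed
  then have "card ?B \<le> card (coprime_triples N \<union> U)"
    using finU finite_coprime_triples by (intro card_mono) auto
  also have "\<dots> \<le> card (coprime_triples N) + card U" by (rule card_Un_le)
  finally have "real (card ?B) \<le> real (card (coprime_triples N)) + real (card U)" by linarith
  moreover have "real (card ?B) = real N ^ 3" by (simp add: card_cartesian_product power3_eq_cube)
  moreover have "real (card U) \<le> real N ^ 3 * (1 / 2)"
  proof -
    have "card U \<le> (\<Sum>d\<in>{2..N}. card ((\<lambda>(x, y, z). (d * x, d * y, d * z)) ` ({1..N div d} \<times> {1..N div d} \<times> {1..N div d})))"
      unfolding U_def by (rule card_UN_le) simp
    also have "\<dots> \<le> (\<Sum>d\<in>{2..N}. card ({1..N div d} \<times> {1..N div d} \<times> {1..N div d}))"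
      by (intro sum_mono card_image_le) simp
    also have "\<dots> = (\<Sum>d\<in>{2..N}. (N div d) ^ 3)"
      by (simp add: card_cartesian_product power3_eq_cube mult.assoc)
    finally have "real (card U) \<le> real (\<Sum>d\<in>{2..N}. (N div d) ^ 3)" unfolding of_nat_le_iff .
    also have "\<dots> = (\<Sum>d\<in>{2..N}. real (N div d) ^ 3)" by simp
    also have "\<dots> \<le> (\<Sum>d\<in>{2..N}. (real N / real d) ^ 3)"
      by (intro sum_mono power_mono real_div_le) simp
    also have "\<dots> = real N ^ 3 * (\<Sum>d\<in>{2..N}. 1 / real d ^ 3)"
      by (simp add: sum_distrib_left power_divide)
    also have "\<dots> \<le> real N ^ 3 * (2 / real 2 ^ 2)"
      by (intro mult_left_mono sum_inverse_cubes_le) auto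
    finally show ?thesis by simp
  qed
  ultimately show ?thesis using assms by (simp add: triple_ratio_def field_simps)
qed

lemma powr_three_halves: "0 < N \<Longrightarrow> real N powr (3 / 2) = sqrt (real N) ^ 3"
  by (simp add: powr_half_sqrt[symmetric] powr_powr powr_realpow[symmetric] del: powr_half_sqrt)

lemma cdf_normalized_frobenius:
  assumes "0 < N"
  shows "cdf (distr (uniform_triples N) borel (normalized_frobenius N)) t
    = card {a \<in> coprime_triples N. normalized_frobenius N a \<le> t} / card (coprime_triples N)"
proof -
  have "(1, 1, 1) \<in> coprime_triples N" using assms by (simp add: coprime_triples_def)
  then have ne: "coprime_triples N \<noteq> {}" by auto
  have "cdf (distr (uniform_triples N) borel (normalized_frobenius N)) t
      = measure (uniform_triples N) (normalized_frobenius N -` {..t} \<inter> space (uniform_triples N))"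
    unfolding cdf_def by (rule measure_distr) (simp_all add: uniform_triples_def)
  also have "\<dots> = card (coprime_triples N \<inter> normalized_frobenius N -` {..t}) / card (coprime_triples N)"
    unfolding uniform_triples_def using ne finite_coprime_triples by (simp add: measure_pmf_of_set)
  also have "coprime_triples N \<inter> normalized_frobenius N -` {..t} = {a \<in> coprime_triples N. normalized_frobenius N a \<le> t}"
    by auto
  finally show ?thesis .
qed

lemma normalized_frobenius_gens:
  assumes "r \<in> admissible N" "primitive r" "0 < N"
  shows "normalized_frobenius N (gens r) \<le> t \<longleftrightarrow> real (frob r) \<le> t * sqrt N ^ 3 + real (gen1 r + gen2 r + gen3 r)"
proof -
  have "normalized_frobenius N (gens r) = (real (frob r) - real (gen1 r + gen2 r + gen3 r)) / sqrt N ^ 3"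
    using assms unfolding normalized_frobenius_def powr_three_halves[OF assms(3)]
    by (simp add: frobenius_number_gens admissible_def)
  moreover have "0 < sqrt N ^ 3" using assms by simp
  ultimately show ?thesis by (simp add: pos_divide_le_eq algebra_simps)
qed

text \<open>Ignoring the sum of the generators gives the lower bound. For the upper one this sum, at
  most \<open>3 * N\<close>, is absorbed by moving the threshold from \<open>t\<close> to
  \<open>s\<close>, and the triples outside the image of \<open>gens\<close> are counted by
  \<open>degenerate_ratio\<close>.\<close>

lemma cdf_bounds:
  assumes "0 < N"
  shows "primitive_ratio 1 t N / triple_ratio N \<le> cdf (distr (uniform_triples N) borel (normalized_frobenius N)) t"
    and "3 * real N \<le> (s - t) * sqrt N ^ 3 \<Longrightarrow>
      cdf (distr (uniform_triples N) borel (normalized_frobenius N)) t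
        \<le> (primitive_ratio 1 s N + degenerate_ratio N) / triple_ratio N"
proof -
  let ?n = "card {a \<in> coprime_triples N. normalized_frobenius N a \<le> t}"
  let ?m = "\<lambda>u. card {r \<in> admissible N. primitive r \<and> 1 * real (frob r) \<le> u * sqrt N ^ 3}"
  let ?k = "card {r \<in> admissible N. primitive r \<and> normalized_frobenius N (gens r) \<le> t}"
  have N3: "0 < real N ^ 3" using assms by simp
  have tr: "0 < triple_ratio N" using triple_ratio_ge[OF assms] by linarith
  have cdf: "cdf (distr (uniform_triples N) borel (normalized_frobenius N)) t = (?n / real N ^ 3) / triple_ratio N"
    unfolding cdf_normalized_frobenius[OF assms] triple_ratio_def using N3 by simp
  have fin: "finite {r \<in> admissible N. \<Psi> r}" for \<Psi> using finite_admissible by simp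
  have "?m t \<le> ?k"
    using normalized_frobenius_gens[OF _ _ assms] fin by (intro card_mono) auto
  also have "?k \<le> ?n" by (rule card_triples_bounds(1))
  finally have "primitive_ratio 1 t N \<le> ?n / real N ^ 3"
    unfolding primitive_ratio_def by (intro divide_right_mono) auto
  then show "primitive_ratio 1 t N / triple_ratio N \<le> cdf (distr (uniform_triples N) borel (normalized_frobenius N)) t"
    unfolding cdf using tr by (intro divide_right_mono) auto
  assume s: "3 * real N \<le> (s - t) * sqrt N ^ 3"
  have "?n \<le> ?k + card {a \<in> coprime_triples N. degenerate a}" by (rule card_triples_bounds(2))
  moreover have "?k \<le> ?m s"
  proof (intro card_mono fin subsetI)
    fix r assume "r \<in> {r \<in> admissible N. primitive r \<and> normalized_frobenius N (gens r) \<le> t}"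
    then have r: "r \<in> admissible N" "primitive r" "normalized_frobenius N (gens r) \<le> t" by auto
    have "real (gen1 r + gen2 r + gen3 r) \<le> 3 * real N" using r(1) by (simp add: admissible_def)
    then have "real (frob r) \<le> s * sqrt N ^ 3"
      using r(3) s unfolding normalized_frobenius_gens[OF r(1,2) assms] by (simp add: algebra_simps)
    then show "r \<in> {r \<in> admissible N. primitive r \<and> 1 * real (frob r) \<le> s * sqrt N ^ 3}" using r by simp
  qed
  ultimately have "real ?n \<le> real (?m s) + real (card {a \<in> coprime_triples N. degenerate a})" by linarith
  then have "?n / real N ^ 3 \<le> primitive_ratio 1 s N + degenerate_ratio N"
    unfolding primitive_ratio_def degenerate_ratio_def add_divide_distrib[symmetric] by (intro divide_right_mono) auto
  then show "cdf (distr (uniform_triples N) borel (normalized_frobenius N)) t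
        \<le> (primitive_ratio 1 s N + degenerate_ratio N) / triple_ratio N"
    unfolding cdf using tr by (intro divide_right_mono) auto
qed

lemma triple_ratio_bounds:
  "primitive_ratio 0 0 N \<le> triple_ratio N" "triple_ratio N \<le> primitive_ratio 0 0 N + degenerate_ratio N"
proof -
  have b: "card {r \<in> admissible N. primitive r \<and> True} \<le> card {a \<in> coprime_triples N. True}"
    "card {a \<in> coprime_triples N. True} \<le> card {r \<in> admissible N. primitive r \<and> True} + card {a \<in> coprime_triples N. degenerate a}"
    by (rule card_triples_bounds[where \<Phi> = "\<lambda>_. True"])+
  then show "primitive_ratio 0 0 N \<le> triple_ratio N"
    unfolding primitive_ratio_def triple_ratio_def by (intro divide_right_mono) auto
  have "real (card (coprime_triples N)) \<le> real (card {r \<in> admissible N. primitive r}) + real (card {a \<in> coprime_triples N. degenerate a})"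
    using b(2) by simp
  then show "triple_ratio N \<le> primitive_ratio 0 0 N + degenerate_ratio N"
    unfolding primitive_ratio_def triple_ratio_def degenerate_ratio_def add_divide_distrib[symmetric]
    by (intro divide_right_mono) auto
qed

theorem theorem5:
  shows "\<exists>M :: real measure. real_distribution M \<and>
    weak_conv_m (\<lambda>N. distr (uniform_triples N) borel (normalized_frobenius N)) M"
proof -
  let ?cdf = "\<lambda>N. cdf (distr (uniform_triples N) borel (normalized_frobenius N))"
  obtain q where q: "primitive_ratio 0 0 \<longlonglongrightarrow> q"
    using convergent_primitive_ratio_nonneg[of 0 0] by (auto simp: convergent_def)
  have "\<exists>l. primitive_ratio 1 t \<longlonglongrightarrow> l" for t
    using convergent_primitive_ratio[of t] by (simp add: convergent_def)
  then obtain g where g: "\<And>t. primitive_ratio 1 t \<longlonglongrightarrow> g t" by metis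
  have tr: "triple_ratio \<longlonglongrightarrow> q"
  proof (rule tendsto_sandwich[OF _ _ q])
    show "(\<lambda>N. primitive_ratio 0 0 N + degenerate_ratio N) \<longlonglongrightarrow> q"
      using tendsto_add[OF q degenerate_ratio_tendsto] by simp
  qed (simp_all add: triple_ratio_bounds)
  have "\<forall>\<^sub>F N in sequentially. 1 / 2 \<le> triple_ratio N"
    using eventually_gt_at_top[of 0] by eventually_elim (rule triple_ratio_ge)
  with tr have q_pos: "1 / 2 \<le> q" by (rule tendsto_lowerbound) simp
  \<comment> \<open>The ratios are normalised by \<open>N ^ 3\<close> instead of the number of
    triples; dividing by the limit \<open>q\<close> of \<open>triple_ratio\<close> turns
    \<open>g\<close> into a distribution function.\<close>
  define G where "G t = g t / q" for t
  have "(\<lambda>N. primitive_ratio 1 t N / triple_ratio N) \<longlonglongrightarrow> G t" for t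
    unfolding G_def using g tr q_pos by (intro tendsto_divide) auto
  note lim_lower = this
  have lim_upper: "(\<lambda>N. (primitive_ratio 1 t N + degenerate_ratio N) / triple_ratio N) \<longlonglongrightarrow> G t" for t
    unfolding G_def using tendsto_add[OF g degenerate_ratio_tendsto] tr q_pos by (intro tendsto_divide) auto
  show ?thesis
  proof (rule weak_limit_if_sandwiched)
    show "G x \<le> G y" if "x \<le> y" for x y
    proof -
      have "g x \<le> g y" using g g by (rule LIMSEQ_le) (use primitive_ratio_mono[OF that] in auto)
      then show ?thesis using q_pos by (simp add: G_def divide_right_mono)
    qed
    have "g t = 0" if "t < 0" for t
    proof -
      have "primitive_ratio 1 t = (\<lambda>_. 0)" using primitive_ratio_neg[OF that] by auto
      then show ?thesis using g[of t] LIMSEQ_unique tendsto_const by metis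
    qed
    then have "G t = 0" if "t < 0" for t using that by (simp add: G_def)
    then have "\<forall>\<^sub>F t in at_bot. G t = 0"
      by (rule eventually_mono[OF eventually_gt_at_bot[of 0], rotated]) auto
    then show "(G \<longlongrightarrow> 0) at_bot" by (rule tendsto_eventually)
    have upper: "G t \<le> 1" for t
    proof -
      have "g t \<le> q" using g q by (rule LIMSEQ_le) (use primitive_ratio_le_total in auto)
      then show ?thesis using q_pos by (simp add: G_def)
    qed
    \<comment> \<open>The tail estimate with \<open>C = t / 3\<close> loses
      \<open>24 / (t / 3) = 72 / t\<close>, which is then divided by \<open>q\<close>.\<close>
    have lower: "1 - 72 / (t * q) \<le> G t" if "0 < t" for t
    proof -
      have "\<forall>\<^sub>F N in sequentially. primitive_ratio 0 0 N - 24 / (t / 3) \<le> primitive_ratio 1 t N"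
        using eventually_gt_at_top[of 0] by eventually_elim (rule primitive_ratio_tail, use that in auto)
      moreover have "(\<lambda>N. primitive_ratio 0 0 N - 24 / (t / 3)) \<longlonglongrightarrow> q - 24 / (t / 3)"
        by (intro tendsto_intros q)
      ultimately have "q - 24 / (t / 3) \<le> g t" using g[of t] by (intro tendsto_le[of sequentially]) auto
      then have "(q - 24 / (t / 3)) / q \<le> g t / q" using q_pos by (intro divide_right_mono) auto
      then show ?thesis using q_pos that by (simp add: G_def diff_divide_distrib)
    qed
    have lim: "((\<lambda>t. 1 - 72 / (t * q)) \<longlongrightarrow> 1) at_top" using q_pos by real_asymp
    have "\<forall>\<^sub>F t in at_top. 1 - 72 / (t * q) \<le> G t"
      using eventually_gt_at_top[of 0] by eventually_elim (rule lower)
    then show "(G \<longlongrightarrow> 1) at_top"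
      by (rule tendsto_sandwich[OF _ _ lim tendsto_const]) (simp add: upper)
    show "\<forall>\<^sub>F N in sequentially. G t - \<epsilon> \<le> ?cdf N t" if "0 < \<epsilon>" for t \<epsilon>
    proof -
      have "\<forall>\<^sub>F N in sequentially. G t - \<epsilon> < primitive_ratio 1 t N / triple_ratio N"
        using lim_lower[of t] by (rule order_tendstoD) (use that in simp)
      then show ?thesis using eventually_gt_at_top[of 0]
        by eventually_elim (use cdf_bounds(1) in \<open>meson less_imp_le order_trans\<close>)
    qed
    show "\<forall>\<^sub>F N in sequentially. ?cdf N t \<le> G s + \<epsilon>" if "t < s" "0 < \<epsilon>" for t s \<epsilon>
    proof -
      have "\<forall>\<^sub>F N in sequentially. (primitive_ratio 1 s N + degenerate_ratio N) / triple_ratio N < G s + \<epsilon>"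
        using lim_upper[of s] by (rule order_tendstoD) (use that in simp)
      moreover have "0 < s - t" using that by simp
      then have "\<forall>\<^sub>F N in sequentially. 3 * real N \<le> (s - t) * sqrt (real N) ^ 3" by real_asymp
      ultimately show ?thesis using eventually_gt_at_top[of 0]
        by eventually_elim (use cdf_bounds(2) in \<open>meson less_imp_le order_trans\<close>)
    qed
  qed
qed

end
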